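(* Let $A=\{\mathbf a_1,\ldots,\mathbf a_n\}$ be a non-pyramidal configuration such that $X_A$ is a self-dual projective toric variety. Then the toric ideal $I_A$ is strongly robust.
   Context: A configuration is a finite list $\mathbf a_1,\ldots,\mathbf a_n$ of vectors in some $\mathbb Z^m$ (repetitions allowed), identified with the integer matrix $A$ having these columns. The vector $\mathbf a_i$ is called free if every $\mathbf u\in\ker_{\mathbb Z}(A)$ has $u_i=0$. The configuration is non-pyramidal if it has no free vectors. Toric varieties: $K$ is an algebraically closed field of characteristic zero. $I_A\subset K[x_1,\ldots,x_n]$ is the toric ideal generated by all binomials $x^{\mathbf u^+}-x^{\mathbf u^-}$, $\mathbf u\in\ker_{\mathbb Z}(A)$, where $\mathbf u=\mathbf u^+-\mathbf u^-$ with $\mathbf u^+,\mathbf u^-\in\mathbb N^n$ of disjoint support. Standing assumption: $(1,\ldots,1)$ lies in the (rational) row span of $A$; then $I_A$ is homogeneous and $X_A=V(I_A)\subset\mathbb P_K^{n-1}$ is a projective toric variety. The dual variety $X_A^*$ is the closure, in the dual projective space, of the set of hyperplanes that intersect the regular points of $X_A$ non-transversally. $X_A$ is self-dual if it is isomorphic to $X_A^*$ as embedded projective varieties, i.e. some linear isomorphism of the ambient projective spaces carries $X_A$ onto $X_A^*$. Toric bases: the Graver basis $\mathrm{Gr}(A)$ consists of all nonzero $\mathbf u\in\ker_{\mathbb Z}(A)$ that cannot be written as $\mathbf u=\mathbf v+\mathbf w$ with $\mathbf v,\mathbf w\in\ker_{\mathbb Z}(A)$ nonzero, $\mathbf u^+=\mathbf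 v^++\mathbf w^+$ and $\mathbf u^-=\mathbf v^-+\mathbf w^-$. A minimal Markov basis of $A$ is a finite set $M\subset\ker_{\mathbb Z}(A)$ such that $\{x^{\mathbf u^+}-x^{\mathbf u^-}:\mathbf u\in M\}$ is a minimal system of binomial generators of $I_A$. The ideal $I_A$ is strongly robust if its Graver basis is equal to a minimal Markov basis of $A$, where opposite vectors $\mathbf u$ and $-\mathbf u$ are identified (i.e. the Graver basis, up to sign, is a minimal generating set). *)

theory Defs
  imports
    "HOL-Analysis.Analysis"
    "HOL-Library.Poly_Mapping"
    "HOL-Library.Extended_Nat"
    "HOL-Computational_Algebra.Polynomial"
begin

text \<open>
  A configuration \<open>a\<^sub>1, \<dots>, a\<^sub>n\<close> in \<open>\<int>\<^sup>m\<close> is the matrix \<open>A :: int^'n^'m\<close> with these columns.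
  Polynomials in the variables indexed by \<open>'n\<close> are finitely supported functions from
  exponent vectors \<open>nat^'n\<close> to coefficients.
\<close>

type_synonym ('k, 'n) polynomials = "(nat^'n) \<Rightarrow>\<^sub>0 'k"


section \<open>Configurations and lattice kernels\<close>

definition int_kernel :: "int^'n^'m \<Rightarrow> (int^'n) set" where
  "int_kernel A = {u. A *v u = 0}"

definition free_vector :: "int^'n^'m \<Rightarrow> 'n \<Rightarrow> bool" where
  "free_vector A i \<longleftrightarrow> (\<forall>u\<in>int_kernel A. u $ i = 0)"

definition non_pyramidal :: "int^'n^'m \<Rightarrow> bool" where
  "non_pyramidal A \<longleftrightarrow> (\<forall>i. \<not> free_vector A i)"

definition ones_in_row_span :: "int^'n^'m \<Rightarrow> bool" where
  "ones_in_row_span A \<longleftrightarrow>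
     (\<chi> j. 1) \<in> vec.span (rows (map_matrix of_int A :: rat^'n^'m))"


section \<open>Polynomials and projective varieties\<close>

definition eval_poly :: "('k::comm_semiring_1, 'n) polynomials \<Rightarrow> 'k^'n \<Rightarrow> 'k" where
  "eval_poly f x =
     (\<Sum>e\<in>Poly_Mapping.keys f. Poly_Mapping.lookup f e * (\<Prod>i\<in>UNIV. (x $ i) ^ (e $ i)))"

definition partial_deriv :: "'n::finite \<Rightarrow> ('k::comm_semiring_1, 'n) polynomials \<Rightarrow> ('k, 'n) polynomials" where
  "partial_deriv i f =
     (\<Sum>e\<in>Poly_Mapping.keys f.
        Poly_Mapping.single (e - axis i 1) (of_nat (e $ i) * Poly_Mapping.lookup f e))"

definition homogeneous_poly :: "('k::zero, 'n::finite) polynomials \<Rightarrow> bool" where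
  "homogeneous_poly f \<longleftrightarrow> (\<exists>d. \<forall>e\<in>Poly_Mapping.keys f. (\<Sum>i\<in>UNIV. e $ i) = d)"

definition ideal_generated :: "'a::comm_ring_1 set \<Rightarrow> 'a set" where
  "ideal_generated = module.span (*)"

text \<open>
  The library constant is the intended one because every commutative ring is a module over itself.
\<close>

lemma module_times: "module ((*) :: 'a::comm_ring_1 \<Rightarrow> 'a \<Rightarrow> 'a)"
  by standard (simp_all add: algebra_simps)

text \<open>
  A subset of \<open>\<P>\<^sup>n\<^sup>-\<^sup>1\<close> is represented by the set of all homogeneous coordinate vectors of its points,
  that is, by a set of nonzero vectors of \<open>'k^'n\<close> (with \<open>n = CARD('n)\<close>) that is closed under
  multiplication by nonzero scalars.  The dual projective space, whose points are the hyperplanes,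
  is coordinatised in the same way: \<open>y \<noteq> 0\<close> stands for the hyperplane \<open>\<Sum>\<^sub>i y\<^sub>i x\<^sub>i = 0\<close>.
\<close>

definition proj_zeros :: "('k::comm_semiring_1, 'n) polynomials set \<Rightarrow> ('k^'n) set" where
  "proj_zeros F = {x. x \<noteq> 0 \<and> (\<forall>f\<in>F. eval_poly f x = 0)}"

definition zariski_closed :: "('k::comm_semiring_1^'n) set \<Rightarrow> bool" where
  "zariski_closed Z \<longleftrightarrow> (\<exists>F. (\<forall>f\<in>F. homogeneous_poly f) \<and> Z = proj_zeros F)"

definition irreducible_closed :: "('k::comm_semiring_1^'n) set \<Rightarrow> bool" where
  "irreducible_closed Z \<longleftrightarrow>
     zariski_closed Z \<and> Z \<noteq> {} \<and>
     (\<forall>C D. zariski_closed C \<longrightarrow> zariski_closed D \<longrightarrow> Z = C \<union> D \<longrightarrow> Z = C \<or> Z = D)"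

text \<open>
  Krull dimension of a closed subset of projective space (the projective, not the affine-cone,
  dimension): the supremum of the lengths of chains of irreducible closed subsets.
\<close>

definition proj_dim :: "('k::comm_semiring_1^'n) set \<Rightarrow> enat" where
  "proj_dim X = Sup {enat k |k. \<exists>Z :: nat \<Rightarrow> ('k^'n) set.
     (\<forall>i\<le>k. irreducible_closed (Z i) \<and> Z i \<subseteq> X) \<and> (\<forall>i<k. Z i \<subset> Z (Suc i))}"

definition hom_vanishing :: "('k::comm_semiring_1^'n) set \<Rightarrow> ('k, 'n) polynomials set" where
  "hom_vanishing X = {f. homogeneous_poly f \<and> (\<forall>x\<in>X. eval_poly f x = 0)}"

text \<open>
  The tangent space at \<open>x\<close> is that of the affine cone over \<open>X\<close>, a linear subspace of \<open>'k^'n\<close>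
  containing \<open>x\<close>; its projectivisation is the embedded projective tangent space.  Its dimension
  therefore exceeds that of the tangent space of \<open>X\<close> itself by one.
\<close>

definition tangent_space :: "('k::comm_semiring_1^'n) set \<Rightarrow> 'k^'n \<Rightarrow> ('k^'n) set" where
  "tangent_space X x =
     {v. \<forall>f\<in>hom_vanishing X. (\<Sum>i\<in>UNIV. eval_poly (partial_deriv i f) x * v $ i) = 0}"

text \<open>
  Regular points by the Jacobian criterion.  The global dimension of \<open>X\<close> is used, so this is
  meant for irreducible \<open>X\<close>, such as toric varieties.
\<close>

definition regular_points :: "('k::field^'n) set \<Rightarrow> ('k^'n) set" where
  "regular_points X = {x\<in>X. enat (vec.dim (tangent_space X x)) = proj_dim X + 1}"

definition hyperplane :: "'k::comm_semiring_1^'n \<Rightarrow> ('k^'n) set" where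
  "hyperplane y = {x. (\<Sum>i\<in>UNIV. y $ i * x $ i) = 0}"

text \<open>
  Being linear, a hyperplane is its own tangent space.  Since both tangent spaces contain \<open>x\<close>,
  transversality can be tested on the affine cones.
\<close>

definition nontransversal_at :: "('k::field^'n) set \<Rightarrow> 'k^'n \<Rightarrow> 'k^'n \<Rightarrow> bool" where
  "nontransversal_at X y x \<longleftrightarrow>
     x \<in> hyperplane y \<and> {v + w |v w. v \<in> tangent_space X x \<and> w \<in> hyperplane y} \<noteq> UNIV"

definition dual_variety :: "('k::field^'n) set \<Rightarrow> ('k^'n) set" where
  "dual_variety X =
     zariski_closed hull {y. y \<noteq> 0 \<and> (\<exists>x\<in>regular_points X. nontransversal_at X y x)}"

definition self_dual :: "('k::field^'n) set \<Rightarrow> bool" where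
  "self_dual X \<longleftrightarrow> (\<exists>P :: 'k^'n^'n. invertible P \<and> (*v) P ` X = dual_variety X)"


section \<open>Toric ideals and toric bases\<close>

definition pos_part :: "int^'n \<Rightarrow> nat^'n" where
  "pos_part u = (\<chi> i. nat (u $ i))"

definition neg_part :: "int^'n \<Rightarrow> nat^'n" where
  "neg_part u = (\<chi> i. nat (- u $ i))"

definition toric_binomial :: "int^'n \<Rightarrow> ('k::comm_ring_1, 'n) polynomials" where
  "toric_binomial u = Poly_Mapping.single (pos_part u) 1 - Poly_Mapping.single (neg_part u) 1"

definition toric_ideal :: "int^'n^'m \<Rightarrow> ('k::comm_ring_1, 'n) polynomials set" where
  "toric_ideal A = ideal_generated (toric_binomial ` int_kernel A)"

definition toric_variety :: "int^'n^'m \<Rightarrow> ('k::comm_ring_1^'n) set" where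
  "toric_variety A = proj_zeros (toric_ideal A)"

definition graver_basis :: "int^'n^'m \<Rightarrow> (int^'n) set" where
  "graver_basis A =
     {u\<in>int_kernel A. u \<noteq> 0 \<and>
        \<not> (\<exists>v\<in>int_kernel A. \<exists>w\<in>int_kernel A. v \<noteq> 0 \<and> w \<noteq> 0 \<and> u = v + w \<and>
             pos_part u = pos_part v + pos_part w \<and> neg_part u = neg_part v + neg_part w)}"

text \<open>
  Minimality is with respect to inclusion.  As \<open>u \<mapsto> toric_binomial u\<close> is injective, subsets of
  \<open>M\<close> correspond to subsets of the set of binomials.  The argument of type \<open>'k itself\<close> fixes
  the coefficient field.
\<close>

definition minimal_markov_basis ::
    "'k::comm_ring_1 itself \<Rightarrow> int^'n^'m \<Rightarrow> (int^'n) set \<Rightarrow> bool" where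
  "minimal_markov_basis K A M \<longleftrightarrow>
     finite M \<and> M \<subseteq> int_kernel A \<and>
     ideal_generated (toric_binomial ` M) = (toric_ideal A :: ('k, 'n) polynomials set) \<and>
     (\<forall>N. N \<subset> M \<longrightarrow>
        ideal_generated (toric_binomial ` N) \<noteq> (toric_ideal A :: ('k, 'n) polynomials set))"

text \<open>Opposite vectors are identified by passing to the unordered pairs \<open>{u, -u}\<close>.\<close>

definition strongly_robust :: "'k::comm_ring_1 itself \<Rightarrow> int^'n^'m \<Rightarrow> bool" where
  "strongly_robust K A \<longleftrightarrow>
     (\<exists>M. minimal_markov_basis K A M \<and>
        (\<lambda>u. {u, - u}) ` graver_basis A = (\<lambda>u. {u, - u}) ` M)"

end

theory Submission
  imports Defs
begin

text \<open>
  Every torus point \<open>x\<close> of \<open>X = X\<^sub>A\<close> is regular, with conormal vectors \<open>p / x\<close> for \<open>p\<close> in the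
  kernel of \<open>A\<close> over \<open>K\<close>.  Hence \<open>X\<^sup>*\<close> contains the translate \<open>p \<cdot> X\<close> for every such \<open>p\<close>
  without zero coordinates.  If \<open>X\<^sup>*\<close> is linearly isomorphic to \<open>X\<close>, then the vanishing forms of
  each degree span spaces of equal finite dimension, so \<open>X\<^sup>* = p \<cdot> X\<close>.  Thus \<open>p' / p\<close> lies in
  \<open>X\<close> for all such \<open>p\<close> and \<open>p'\<close>: for a lattice vector \<open>u\<close> in the kernel, \<open>\<Prod>\<^sub>i p\<^sub>i ^ u\<^sub>i\<close> is
  independent of \<open>p\<close>.  Letting \<open>p\<close> approach a generic point of \<open>p\<^sub>i = 0\<close> shows that \<open>u\<close> sums to
  zero over the coordinates that are proportional to the \<open>i\<close>-th one on the kernel, so some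
  coordinate is a negative multiple of the \<open>i\<close>-th one.

  Then \<open>v\<^sup>+ \<le> u\<^sup>+\<close> already forces \<open>v\<^sup>- \<le> u\<^sup>-\<close> for \<open>u, v\<close> in the kernel.  For a Graver element
  \<open>u\<close>, the monomial \<open>x^(u\<^sup>+)\<close> is therefore not divisible by a term of any binomial other than
  \<open>0\<close> and those of \<open>u\<close> and \<open>-u\<close>, so \<open>u\<close> or \<open>-u\<close> belongs to every Markov basis.
\<close>

section \<open>Lattice kernels\<close>

lemma int_kernel_iff: "u \<in> int_kernel A \<longleftrightarrow> (\<forall>k. (\<Sum>i\<in>UNIV. A $ k $ i * u $ i) = 0)"
  by (simp add: int_kernel_def matrix_vector_mult_def vec_eq_iff)

lemma int_kernel_zero [simp]: "0 \<in> int_kernel A"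
  by (simp add: int_kernel_iff)

lemma int_kernel_add: "u \<in> int_kernel A \<Longrightarrow> v \<in> int_kernel A \<Longrightarrow> u + v \<in> int_kernel A"
  by (simp add: int_kernel_iff algebra_simps sum.distrib)

lemma int_kernel_scale: "u \<in> int_kernel A \<Longrightarrow> c *s u \<in> int_kernel A"
  by (simp add: int_kernel_iff mult.left_commute flip: sum_distrib_left)

lemma int_kernel_uminus: "u \<in> int_kernel A \<Longrightarrow> - u \<in> int_kernel A"
  by (simp add: int_kernel_iff sum_negf)

lemma int_kernel_diff: "u \<in> int_kernel A \<Longrightarrow> v \<in> int_kernel A \<Longrightarrow> u - v \<in> int_kernel A"
  using int_kernel_add[of u A "- v"] int_kernel_uminus[of v A] by simp

lemma int_kernel_sum: "(\<And>i. i \<in> I \<Longrightarrow> f i \<in> int_kernel A) \<Longrightarrow> sum f I \<in> int_kernel A"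
  by (induction I rule: infinite_finite_induct) (auto intro: int_kernel_add)

lemma int_kernel_saturated: "c *s u \<in> int_kernel A \<Longrightarrow> c \<noteq> 0 \<Longrightarrow> u \<in> int_kernel A"
  by (simp add: int_kernel_iff mult.left_commute flip: sum_distrib_left)


section \<open>Conformal vectors and the Graver basis\<close>

text \<open>Each coordinate of \<open>v\<close> lies between 0 and that of \<open>u\<close>; the
  minimal nonzero kernel vectors of this order are the Graver elements.\<close>

definition conformal_le :: "int^'n \<Rightarrow> int^'n \<Rightarrow> bool" where
  "conformal_le v u \<longleftrightarrow> (\<forall>i. (v $ i > 0 \<longrightarrow> v $ i \<le> u $ i) \<and> (v $ i < 0 \<longrightarrow> u $ i \<le> v $ i))"

lemma conformal_diff:
  assumes "conformal_le v u"
  shows "pos_part u = pos_part v + pos_part (u - v)" "neg_part u = neg_part v + neg_part (u - v)"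
proof -
  have *: "nat (u $ i) = nat (v $ i) + nat (u $ i - v $ i) \<and>
      nat (- u $ i) = nat (- v $ i) + nat (v $ i - u $ i)" for i
    using assms[unfolded conformal_le_def, rule_format, of i] by arith
  show "pos_part u = pos_part v + pos_part (u - v)" "neg_part u = neg_part v + neg_part (u - v)"
    using * by (simp_all add: pos_part_def neg_part_def vec_eq_iff)
qed

lemma conformal_sum_le:
  assumes "pos_part u = pos_part v + pos_part w" "neg_part u = neg_part v + neg_part w"
  shows "conformal_le v u"
proof -
  have *: "nat (u $ i) = nat (v $ i) + nat (w $ i)" "nat (- u $ i) = nat (- v $ i) + nat (- w $ i)" for i
    using assms by (simp_all add: pos_part_def neg_part_def vec_eq_iff)
  have "(v $ i > 0 \<longrightarrow> v $ i \<le> u $ i) \<and> (v $ i < 0 \<longrightarrow> u $ i \<le> v $ i)" for i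
    using *[of i] by arith
  then show ?thesis by (simp add: conformal_le_def)
qed

text \<open>The second summand of a forbidden decomposition can only be \<open>u - v\<close>, and
  the sign parts add up exactly when \<open>v\<close> is conformal to \<open>u\<close>.\<close>

lemma graver_iff:
  "u \<in> graver_basis A \<longleftrightarrow>
     u \<in> int_kernel A \<and> u \<noteq> 0 \<and> (\<forall>v\<in>int_kernel A. conformal_le v u \<longrightarrow> v = 0 \<or> v = u)"
proof (intro iffI conjI ballI impI)
  assume u: "u \<in> graver_basis A"
  then show uk: "u \<in> int_kernel A" and "u \<noteq> 0" by (simp_all add: graver_basis_def)
  fix v assume v: "v \<in> int_kernel A" "conformal_le v u"
  show "v = 0 \<or> v = u"
  proof (rule ccontr)
    assume "\<not> (v = 0 \<or> v = u)"
    then have "\<exists>v\<in>int_kernel A. \<exists>w\<in>int_kernel A. v \<noteq> 0 \<and> w \<noteq> 0 \<and> u = v + w \<and>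
             pos_part u = pos_part v + pos_part w \<and> neg_part u = neg_part v + neg_part w"
      using conformal_diff[OF v(2)] v(1) uk
      by (intro bexI[of _ v] bexI[of _ "u - v"]) (auto intro: int_kernel_diff)
    with u show False unfolding graver_basis_def by blast
  qed
next
  assume *: "u \<in> int_kernel A \<and> u \<noteq> 0 \<and> (\<forall>v\<in>int_kernel A. conformal_le v u \<longrightarrow> v = 0 \<or> v = u)"
  then show "u \<in> graver_basis A"
    unfolding graver_basis_def
  proof (safe, goal_cases)
    case (1 v w)
    then have "v = 0 \<or> v = v + w" using conformal_sum_le[of "v + w" v w] by blast
    with 1 show ?case by simp
  qed
qed

lemma graver_uminus: "u \<in> graver_basis A \<Longrightarrow> - u \<in> graver_basis A"
  unfolding graver_iff
proof (intro conjI ballI impI; elim conjE)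
  fix v assume u: "\<forall>v\<in>int_kernel A. conformal_le v u \<longrightarrow> v = 0 \<or> v = u"
    and v: "v \<in> int_kernel A" "conformal_le v (- u)"
  have "conformal_le (- v) u"
    using v(2) by (auto simp: conformal_le_def le_minus_iff minus_le_iff)
  with u int_kernel_uminus[OF v(1)] show "v = 0 \<or> v = - u"
    by (metis add.inverse_inverse neg_equal_0_iff_equal)
qed (auto intro: int_kernel_uminus)

section \<open>Dickson's lemma and finiteness of the Graver basis\<close>

lemma incseq_subseq_nat:
  fixes s :: "nat \<Rightarrow> nat"
  shows "\<exists>r. strict_mono r \<and> incseq (s \<circ> r)"
proof -
  obtain f where f: "strict_mono f" "monoseq (\<lambda>n. s (f n))"
    using seq_monosub by blast
  show ?thesis
  proof (cases "incseq (\<lambda>n. s (f n))")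
    case True
    with f show ?thesis by (auto simp: o_def)
  next
    case False
    with f have dec: "decseq (\<lambda>n. s (f n))" by (simp add: monoseq_iff)
    \<comment> \<open>A decreasing sequence of naturals reaches its minimum and stays there, so the
      tail from that index is constant, hence increasing.\<close>
    define m where "m = (LEAST y. y \<in> range (\<lambda>n. s (f n)))"
    have "m \<in> range (\<lambda>n. s (f n))" unfolding m_def by (rule LeastI[of _ "s (f 0)"]) auto
    then obtain k where k: "m = s (f k)" by auto
    have "s (f (n + k)) = m" for n
      using decseqD[OF dec, of k "n + k"] Least_le[of "\<lambda>y. y \<in> range (\<lambda>n. s (f n))" "s (f (n + k))"]
      by (auto simp: k m_def[symmetric] intro!: antisym)
    then have "incseq (s \<circ> (\<lambda>n. f (n + k)))" by (simp add: o_def)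
    moreover have "strict_mono (\<lambda>n. f (n + k))" using f(1) by (simp add: strict_mono_def)
    ultimately show ?thesis by blast
  qed
qed

text \<open>Coordinates are thinned out one after another; passing to a further subsequence keeps
  the earlier ones monotone.\<close>

lemma dickson_subseq:
  fixes s :: "'i \<Rightarrow> nat \<Rightarrow> nat"
  assumes "finite I"
  shows "\<exists>r. strict_mono r \<and> (\<forall>i\<in>I. incseq (s i \<circ> r))"
  using assms
proof (induction I)
  case empty
  then show ?case by (intro exI[of _ id]) (simp add: strict_mono_def)
next
  case (insert j I)
  then obtain r where r: "strict_mono r" "\<forall>i\<in>I. incseq (s i \<circ> r)" by blast
  obtain q where q: "strict_mono q" "incseq ((s j \<circ> r) \<circ> q)"
    using incseq_subseq_nat by blast
  have "incseq (s i \<circ> (r \<circ> q))" if "i \<in> I" for i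
    using r(2) that q(1) by (auto simp: incseq_def strict_mono_less_eq)
  moreover have "incseq (s j \<circ> (r \<circ> q))" using q(2) by (simp add: o_assoc)
  ultimately show ?case
    using strict_mono_o[OF r(1) q(1)] by blast
qed

text \<open>Graver elements are pairwise incomparable for \<open>conformal_le\<close>, whereas
  Dickson's lemma finds a comparable pair in any injective sequence.\<close>

lemma finite_graver:
  fixes A :: "int^'n^'m"
  shows "finite (graver_basis A)"
proof (rule ccontr)
  assume "infinite (graver_basis A)"
  then obtain f :: "nat \<Rightarrow> int^'n" where f: "inj f" "range f \<subseteq> graver_basis A"
    using infinite_countable_subset by blast
  \<comment> \<open>Positive and negative parts are tracked as separate natural coordinates;
    monotonicity in both gives conformality.\<close>
  define s where "s = (\<lambda>(i, b) k. if b then nat (f k $ i) else nat (- f k $ i))"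
  obtain r where r: "strict_mono r" "\<And>i. incseq (s i \<circ> r)"
    using dickson_subseq[of UNIV s] by auto
  have "nat (f (r 0) $ i) \<le> nat (f (r 1) $ i)" "nat (- f (r 0) $ i) \<le> nat (- f (r 1) $ i)" for i
    using incseqD[OF r(2)[of "(i, True)"], of 0 1] incseqD[OF r(2)[of "(i, False)"], of 0 1]
    by (simp_all add: s_def)
  note le = this
  have "(f (r 0) $ i > 0 \<longrightarrow> f (r 0) $ i \<le> f (r 1) $ i) \<and>
      (f (r 0) $ i < 0 \<longrightarrow> f (r 1) $ i \<le> f (r 0) $ i)" for i
    using le[of i] by arith
  then have "conformal_le (f (r 0)) (f (r 1))" by (simp add: conformal_le_def)
  moreover have "f (r 0) \<noteq> f (r 1)"
    using f(1) r(1) by (metis injD less_irrefl strict_mono_def zero_less_one)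
  moreover have "f (r 0) \<in> graver_basis A" "f (r 1) \<in> graver_basis A" using f(2) by auto
  ultimately show False unfolding graver_iff by blast
qed


section \<open>Binomial generators of the toric ideal\<close>

lemma toric_binomial_uminus: "toric_binomial (- u) = - toric_binomial u"
  by (simp add: toric_binomial_def pos_part_def neg_part_def)

text \<open>Telescoping through the mixed monomial with exponent
  \<open>neg_part v + pos_part w\<close>.\<close>

lemma toric_binomial_conformal:
  assumes "pos_part u = pos_part v + pos_part w" "neg_part u = neg_part v + neg_part w"
  shows "(toric_binomial u :: ('k::comm_ring_1, 'n::finite) polynomials) =
    Poly_Mapping.single (pos_part w) 1 * toric_binomial v +
    Poly_Mapping.single (neg_part v) 1 * toric_binomial w"
proof -
  have *: "Poly_Mapping.single (a + b) (1::'k) = Poly_Mapping.single a 1 * Poly_Mapping.single b 1"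
    for a b :: "nat^'n"
    by (simp add: mult_single)
  show ?thesis
    unfolding toric_binomial_def assms * by (simp add: algebra_simps)
qed

lemma ideal_generated_base: "x \<in> S \<Longrightarrow> x \<in> ideal_generated S"
  unfolding ideal_generated_def by (rule module.span_base[OF module_times])

lemma ideal_generated_mono: "S \<subseteq> T \<Longrightarrow> ideal_generated S \<subseteq> ideal_generated T"
  unfolding ideal_generated_def by (rule module.span_mono[OF module_times])

lemma ideal_generated_minimal: "S \<subseteq> ideal_generated T \<Longrightarrow> ideal_generated S \<subseteq> ideal_generated T"
  unfolding ideal_generated_def
  by (rule module.span_minimal[OF module_times]) (auto intro: module.subspace_span[OF module_times])

lemma ideal_generated_add: "x \<in> ideal_generated S \<Longrightarrow> y \<in> ideal_generated S \<Longrightarrow> x + y \<in> ideal_generated S"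
  unfolding ideal_generated_def by (rule module.span_add[OF module_times])

lemma ideal_generated_times: "x \<in> ideal_generated S \<Longrightarrow> c * x \<in> ideal_generated S"
  unfolding ideal_generated_def by (rule module.span_scale[OF module_times])

lemma ideal_generated_uminus: "x \<in> ideal_generated S \<Longrightarrow> - x \<in> ideal_generated S"
  using ideal_generated_times[of x S "- 1"] by simp

lemma ideal_generated_induct [consumes 1, case_names zero step]:
  assumes "x \<in> ideal_generated S" "P 0" "\<And>c x y. x \<in> S \<Longrightarrow> P y \<Longrightarrow> P (c * x + y)"
  shows "P x"
  using module.span_induct_alt[OF module_times, of x S P] assms unfolding ideal_generated_def by blast

lemma pos_neg_parts: "int (pos_part u $ i) - int (neg_part u $ i) = u $ i"
  by (simp add: pos_part_def neg_part_def)

text \<open>Induction on the 1-norm: a nonzero kernel vector outside the Graver basis splits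
  conformally into two kernel vectors of smaller norm.\<close>

lemma graver_generates:
  assumes "u \<in> int_kernel A"
  shows "(toric_binomial u :: ('k::comm_ring_1, 'n::finite) polynomials) \<in>
    ideal_generated (toric_binomial ` graver_basis A)"
  using assms
proof (induction "nat (\<Sum>i\<in>UNIV. \<bar>u $ i\<bar>)" arbitrary: u rule: less_induct)
  case less
  consider "u = 0" | "u \<in> graver_basis A" | v where "v \<in> int_kernel A" "conformal_le v u" "v \<noteq> 0" "v \<noteq> u"
    using less.prems unfolding graver_iff by blast
  then show ?case
  proof cases
    case 1
    then have "toric_binomial u = (0 :: ('k, 'n) polynomials)"
      by (simp add: toric_binomial_def pos_part_def neg_part_def)
    then show ?thesis
      unfolding ideal_generated_def using module.span_zero[OF module_times] by metis
  next
    case 2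
    then show ?thesis by (intro ideal_generated_base) simp
  next
    case 3
    have abs: "\<bar>u $ i\<bar> = \<bar>v $ i\<bar> + \<bar>(u - v) $ i\<bar>" for i
      using 3(2)[unfolded conformal_le_def, rule_format, of i] by auto
    have pos: "(\<Sum>i\<in>UNIV. \<bar>w $ i\<bar>) > 0" if nz: "w \<noteq> 0" for w :: "int^'n"
    proof -
      obtain i where "w $ i \<noteq> 0" using nz by (auto simp: vec_eq_iff)
      then show ?thesis by (intro sum_pos2[of _ i]) auto
    qed
    have "(\<Sum>i\<in>UNIV. \<bar>u $ i\<bar>) = (\<Sum>i\<in>UNIV. \<bar>v $ i\<bar>) + (\<Sum>i\<in>UNIV. \<bar>(u - v) $ i\<bar>)"
      unfolding sum.distrib[symmetric] by (rule sum.cong) (auto simp: abs)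
    with pos[of v] pos[of "u - v"] 3
    have "nat (\<Sum>i\<in>UNIV. \<bar>v $ i\<bar>) < nat (\<Sum>i\<in>UNIV. \<bar>u $ i\<bar>)"
         "nat (\<Sum>i\<in>UNIV. \<bar>(u - v) $ i\<bar>) < nat (\<Sum>i\<in>UNIV. \<bar>u $ i\<bar>)" by auto
    then have "toric_binomial v \<in> ideal_generated (toric_binomial ` graver_basis A :: ('k, 'n) polynomials set)"
        "toric_binomial (u - v) \<in> ideal_generated (toric_binomial ` graver_basis A :: ('k, 'n) polynomials set)"
      using 3(1) less int_kernel_diff by blast+
    then show ?thesis
      unfolding toric_binomial_conformal[OF conformal_diff[OF 3(2)]]
      by (intro ideal_generated_add ideal_generated_times)
  qed
qed

lemma poly_sum_single: "f = (\<Sum>e\<in>Poly_Mapping.keys f. Poly_Mapping.single e (Poly_Mapping.lookup f e))"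
  by (rule poly_mapping_eqI) (simp add: lookup_sum lookup_single when_def sum.delta in_keys_iff)

lemma lookup_times_single_one:
  fixes c :: "('a::{cancel_comm_monoid_add}) \<Rightarrow>\<^sub>0 ('k::comm_ring_1)"
  assumes "Poly_Mapping.lookup (c * Poly_Mapping.single a 1) k \<noteq> 0"
  shows "\<exists>b. k = b + a"
proof (rule ccontr)
  assume nex: "\<nexists>b. k = b + a"
  have "c * Poly_Mapping.single a 1 = (\<Sum>e\<in>Poly_Mapping.keys c. Poly_Mapping.single (e + a) (Poly_Mapping.lookup c e))"
    by (subst (1) poly_sum_single[of c]) (simp add: sum_distrib_right mult_single)
  then have "Poly_Mapping.lookup (c * Poly_Mapping.single a 1) k = 0"
    using nex by (auto simp: lookup_sum lookup_single when_def intro!: sum.neutral)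
  with assms show False by simp
qed

text \<open>The coefficient at \<open>pos_part u\<close> is 1 in the binomial of \<open>u\<close>
  but zero throughout the ideal generated by \<open>N\<close>, since no term of a generator divides
  that monomial.\<close>

lemma graver_indispensable:
  fixes A :: "int^'n^'m"
  assumes mixed: "\<And>i. \<exists>j a b. a > 0 \<and> b > 0 \<and> (\<forall>u\<in>int_kernel A. a * u $ j = - b * u $ i)"
    and u: "u \<in> graver_basis A" and N: "N \<subseteq> int_kernel A" "0 \<notin> N" "u \<notin> N" "- u \<notin> N"
  shows "toric_binomial u \<notin> ideal_generated (toric_binomial ` N :: ('k::comm_ring_1, 'n) polynomials set)"
proof
  have uk: "u \<in> int_kernel A" and u0: "u \<noteq> 0" using u by (simp_all add: graver_iff)
  \<comment> \<open>Where \<open>v\<close> is negative at \<open>i\<close>, it is positive at the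
    partner \<open>j\<close>; the bound at \<open>j\<close> transfers back to \<open>i\<close>
    through the fixed negative ratio.\<close>
  have conf: "conformal_le v u" if v: "v \<in> int_kernel A" and le: "\<And>i. v $ i > 0 \<Longrightarrow> v $ i \<le> u $ i" for v
    unfolding conformal_le_def
  proof (intro allI conjI impI)
    fix i assume neg: "v $ i < 0"
    obtain j a b where ab: "a > 0" "b > 0" "\<And>u. u \<in> int_kernel A \<Longrightarrow> a * u $ j = - b * u $ i"
      using mixed by meson
    have "a * v $ j > 0" using ab neg v by (simp add: mult_less_0_iff)
    then have "v $ j > 0" using ab(1) by (simp add: zero_less_mult_iff)
    then have "a * v $ j \<le> a * u $ j" using le ab(1) by simp
    then show "u $ i \<le> v $ i" using ab v uk by simp
  qed (use le in auto)
  have N2: "\<not> conformal_le v u" "\<not> conformal_le (- v) u" if "v \<in> N" for v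
    using u N that unfolding graver_iff by (metis int_kernel_uminus neg_equal_0_iff_equal subsetD add.inverse_inverse)+
  have part: "conformal_le v u" if v: "v \<in> int_kernel A" and eq: "pos_part u = b + pos_part v" for v b
  proof (rule conf[OF v])
    fix i assume "v $ i > 0"
    moreover have "nat (u $ i) = b $ i + nat (v $ i)" using eq by (simp add: pos_part_def vec_eq_iff)
    ultimately show "v $ i \<le> u $ i" by linarith
  qed
  have neg: "neg_part v = pos_part (- v)" for v :: "int^'n" by (simp add: neg_part_def pos_part_def)
  have vanish: "Poly_Mapping.lookup f (pos_part u) = 0"
    if "f \<in> ideal_generated (toric_binomial ` N :: ('k, 'n) polynomials set)" for f
    using that
  proof (induction rule: ideal_generated_induct)
    case (step c x y)
    then obtain v where v: "v \<in> N" "x = toric_binomial v" by auto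
    have vk: "v \<in> int_kernel A" using v N by auto
    have "Poly_Mapping.lookup (c * Poly_Mapping.single (pos_part v) 1) (pos_part u) = 0"
      using lookup_times_single_one part[OF vk] N2(1)[OF v(1)] by blast
    moreover have "Poly_Mapping.lookup (c * Poly_Mapping.single (neg_part v) 1) (pos_part u) = 0"
      unfolding neg using lookup_times_single_one part[OF int_kernel_uminus[OF vk]] N2(2)[OF v(1)] by blast
    ultimately show ?case
      using step by (simp add: v(2) toric_binomial_def right_diff_distrib lookup_add lookup_minus)
  qed simp
  have "pos_part u \<noteq> neg_part u"
  proof
    assume "pos_part u = neg_part u"
    then have "u $ i = 0" for i using pos_neg_parts[of u i] by simp
    with u0 show False by (simp add: vec_eq_iff)
  qed
  then have "Poly_Mapping.lookup (toric_binomial u :: ('k, 'n) polynomials) (pos_part u) = 1"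
    by (simp add: toric_binomial_def lookup_minus lookup_single when_def)
  moreover assume "toric_binomial u \<in> ideal_generated (toric_binomial ` N :: ('k, 'n) polynomials set)"
  ultimately show False using vanish by fastforce
qed

text \<open>One Graver element is chosen from each pair \<open>{u, - u}\<close>; omitting any of
  these loses its binomial by \<open>graver_indispensable\<close>.\<close>

theorem strongly_robust_if_mixed:
  fixes A :: "int^'n^'m"
  assumes mixed: "\<And>i. \<exists>j a b. a > 0 \<and> b > 0 \<and> (\<forall>u\<in>int_kernel A. a * u $ j = - b * u $ i)"
  shows "strongly_robust TYPE('k::comm_ring_1) A"
proof -
  define rep where "rep = (\<lambda>S :: (int^'n) set. SOME x. x \<in> S)"
  define M where "M = (\<lambda>u. rep {u, - u}) ` graver_basis A"
  have rep: "rep {u, - u} = u \<or> rep {u, - u} = - u" for u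
    unfolding rep_def using someI[of "\<lambda>x. x \<in> {u, - u}" u] by auto
  have repset: "{rep {u, - u}, - rep {u, - u}} = {u, - u}" for u
    using rep[of u] by auto
  have MG: "M \<subseteq> graver_basis A" 
  proof
    fix x assume "x \<in> M"
    then obtain u where "u \<in> graver_basis A" "x = rep {u, - u}" by (auto simp: M_def)
    then show "x \<in> graver_basis A" using rep[of u] graver_uminus[of u A] by auto
  qed
  then have Mk: "M \<subseteq> int_kernel A" "0 \<notin> M" by (auto simp: graver_basis_def)
  have uniq: "- m \<notin> M" if "m \<in> M" for m
  proof
    assume "- m \<in> M"
    \<comment> \<open>The choice \<open>rep\<close> depends only on the unordered pair, so
      \<open>m\<close> and \<open>- m\<close> in \<open>M\<close> would both equal the
      representative of the same pair.\<close>
    have fix_rep: "rep {x, - x} = x" if x: "x \<in> M" for x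
    proof -
      obtain u where u: "x = rep {u, - u}" using x by (auto simp: M_def)
      then show ?thesis using repset[of u] by simp
    qed
    from fix_rep[OF \<open>- m \<in> M\<close>] fix_rep[OF that] have "m = - m" by (simp add: insert_commute)
    then have "m = 0" by (simp add: vec_eq_iff)
    with that Mk show False by simp
  qed
  have gen: "ideal_generated (toric_binomial ` M) = (toric_ideal A :: ('k, 'n) polynomials set)"
  proof
    show "ideal_generated (toric_binomial ` M) \<subseteq> (toric_ideal A :: ('k, 'n) polynomials set)"
      unfolding toric_ideal_def using Mk by (intro ideal_generated_mono image_mono)
    have "toric_binomial u \<in> ideal_generated (toric_binomial ` M :: ('k, 'n) polynomials set)"
      if "u \<in> graver_basis A" for u
    proof -
      have m: "rep {u, - u} \<in> M" using that by (auto simp: M_def)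
      then have "toric_binomial (rep {u, - u}) \<in> ideal_generated (toric_binomial ` M :: ('k, 'n) polynomials set)"
        by (intro ideal_generated_base) simp
      then show ?thesis
        using rep[of u] ideal_generated_uminus by (metis toric_binomial_uminus add.inverse_inverse)
    qed
    then have *: "ideal_generated (toric_binomial ` graver_basis A) \<subseteq>
        ideal_generated (toric_binomial ` M :: ('k, 'n) polynomials set)"
      by (intro ideal_generated_minimal) auto
    have "toric_binomial ` int_kernel A \<subseteq> ideal_generated (toric_binomial ` M :: ('k, 'n) polynomials set)"
      using graver_generates * by blast
    then show "(toric_ideal A :: ('k, 'n) polynomials set) \<subseteq> ideal_generated (toric_binomial ` M)"
      unfolding toric_ideal_def by (rule ideal_generated_minimal)
  qed
  have "ideal_generated (toric_binomial ` N) \<noteq> (toric_ideal A :: ('k, 'n) polynomials set)" if N: "N \<subset> M" for N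
  proof -
    obtain m where m: "m \<in> M" "m \<notin> N" using N by auto
    have "toric_binomial m \<notin> ideal_generated (toric_binomial ` N :: ('k, 'n) polynomials set)"
      by (rule graver_indispensable[OF mixed]) (use m N MG Mk uniq[OF m(1)] in auto)
    moreover have "toric_binomial m \<in> (toric_ideal A :: ('k, 'n) polynomials set)"
      unfolding toric_ideal_def using m Mk by (intro ideal_generated_base) auto
    ultimately show ?thesis by metis
  qed
  then have "minimal_markov_basis TYPE('k) A M"
    unfolding minimal_markov_basis_def
    using gen Mk(1) finite_subset[OF MG finite_graver] by simp
  moreover have "(\<lambda>u. {u, - u}) ` graver_basis A = (\<lambda>u. {u, - u}) ` M"
    unfolding M_def image_image repset ..
  ultimately show ?thesis unfolding strongly_robust_def by blast
qed


section \<open>Forms\<close>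

definition monom_val :: "nat^'n \<Rightarrow> 'k::comm_semiring_1^'n \<Rightarrow> 'k" where
  "monom_val e x = (\<Prod>i\<in>UNIV. x $ i ^ e $ i)"

definition exps :: "nat \<Rightarrow> (nat^'n) set" where
  "exps D = {e. (\<Sum>i\<in>UNIV. e $ i) = D}"

text \<open>Homogeneous polynomials are treated as functions, which makes products and substitutions
  immediate; the zero function is a form of every degree.\<close>

definition form :: "nat \<Rightarrow> ('k::comm_semiring_1^'n \<Rightarrow> 'k) \<Rightarrow> bool" where
  "form D f \<longleftrightarrow> (\<exists>c. \<forall>x. f x = (\<Sum>e\<in>exps D. c e * monom_val e x))"

lemma monom_val_add: "monom_val (a + b) x = monom_val a x * monom_val b x"
  by (simp add: monom_val_def power_add prod.distrib)

lemma monom_val_axis: "monom_val (axis i 1) x = x $ i"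
proof -
  have "monom_val (axis i 1) x = (\<Prod>j\<in>UNIV. if j = i then x $ j else 1)"
    unfolding monom_val_def by (rule prod.cong) (auto simp: axis_def)
  then show ?thesis by (simp add: prod.delta)
qed

lemma finite_exps [simp]: "finite (exps D :: (nat^'n::finite) set)"
proof -
  have "vec_nth ` (exps D :: (nat^'n) set) \<subseteq> PiE UNIV (\<lambda>_. {..D})"
    by (auto simp: exps_def intro!: member_le_sum)
  then have "finite (vec_nth ` (exps D :: (nat^'n) set))"
    by (rule finite_subset) (simp add: finite_PiE)
  then show ?thesis by (rule finite_imageD) (simp add: inj_on_def vec_nth_inject)
qed

lemma exps_add: "a \<in> exps m \<Longrightarrow> b \<in> exps n \<Longrightarrow> a + b \<in> exps (m + n)"
  by (simp add: exps_def sum.distrib)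

lemma form_zero: "form D (\<lambda>_. 0)"
  unfolding form_def by (rule exI[of _ "\<lambda>_. 0"]) simp

lemma form_add:
  assumes "form D f" "form D g" shows "form D (\<lambda>x. f x + g x)"
proof -
  obtain c d where "\<And>x. f x = (\<Sum>e\<in>exps D. c e * monom_val e x)" "\<And>x. g x = (\<Sum>e\<in>exps D. d e * monom_val e x)"
    using assms unfolding form_def by blast
  then show ?thesis unfolding form_def
    by (intro exI[of _ "\<lambda>e. c e + d e"]) (simp add: algebra_simps sum.distrib)
qed

lemma form_scale:
  assumes "form D f" shows "form D (\<lambda>x. c * f x)"
proof -
  obtain d where "\<And>x. f x = (\<Sum>e\<in>exps D. d e * monom_val e x)"
    using assms unfolding form_def by blast
  then show ?thesis unfolding form_def
    by (intro exI[of _ "\<lambda>e. c * d e"]) (simp add: sum_distrib_left mult.assoc)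
qed

lemma form_sum: "(\<And>i. i \<in> I \<Longrightarrow> form D (f i)) \<Longrightarrow> form D (\<lambda>x. \<Sum>i\<in>I. f i x)"
  by (induction I rule: infinite_finite_induct) (auto intro: form_zero form_add)

lemma form_monom:
  assumes "e \<in> exps D" shows "form D (monom_val e)"
  unfolding form_def using assms
  by (intro exI[of _ "\<lambda>e'. if e' = e then 1 else 0"]) (simp add: if_distrib[of "\<lambda>c. c * _"] sum.delta cong: if_cong)

lemma form_mult:
  assumes "form a f" "form b g" shows "form (a + b) (\<lambda>x. f x * g x)"
proof -
  obtain c d where "\<And>x. f x = (\<Sum>e\<in>exps a. c e * monom_val e x)" "\<And>x. g x = (\<Sum>e\<in>exps b. d e * monom_val e x)"
    using assms unfolding form_def by blast
  then have "(\<lambda>x. f x * g x) = (\<lambda>x. \<Sum>e\<in>exps a. \<Sum>e'\<in>exps b. (c e * d e') * monom_val (e + e') x)"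
    by (simp add: sum_product monom_val_add algebra_simps)
  then show ?thesis
    by (auto intro!: form_sum form_scale form_monom exps_add)
qed

lemma form_const: "form 0 (\<lambda>_. c)"
  using form_scale[OF form_monom[of 0 0], of c] by (simp add: exps_def monom_val_def)

lemma form_power: "form D f \<Longrightarrow> form (k * D) (\<lambda>x. f x ^ k)"
  by (induction k) (auto intro: form_const dest: form_mult)

lemma form_prod: "(\<And>i. i \<in> I \<Longrightarrow> form (D i) (f i)) \<Longrightarrow> form (\<Sum>i\<in>I. D i) (\<lambda>x. \<Prod>i\<in>I. f i x)"
  by (induction I rule: infinite_finite_induct) (auto intro: form_const form_mult)

lemma form_coord: "form 1 (\<lambda>x. x $ i)"
proof -
  have "axis i 1 \<in> exps 1" by (simp add: exps_def axis_def)
  from form_monom[OF this] show ?thesis unfolding monom_val_axis[abs_def] .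
qed

lemma form_subst:
  assumes "form D f" "\<And>i. form 1 (\<lambda>x. L x $ i)"
  shows "form D (\<lambda>x. f (L x))"
proof -
  obtain c where c: "\<And>x. f x = (\<Sum>e\<in>exps D. c e * monom_val e x)"
    using assms unfolding form_def by blast
  have "form D (\<lambda>x. monom_val e (L x))" if "e \<in> exps D" for e
  proof -
    have "form (\<Sum>i\<in>UNIV. e $ i * 1) (\<lambda>x. monom_val e (L x))"
      unfolding monom_val_def by (intro form_prod form_power assms)
    with that show ?thesis by (simp add: exps_def)
  qed
  then show ?thesis unfolding c by (intro form_sum form_scale)
qed

lemma form_matrix: "form 1 (\<lambda>x. (Q *v x) $ i)"
  unfolding matrix_vector_mult_def by (simp add: form_sum form_scale form_coord[unfolded One_nat_def])

lemma eval_poly_superset: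
  assumes "finite E" "Poly_Mapping.keys f \<subseteq> E"
  shows "eval_poly f x = (\<Sum>e\<in>E. Poly_Mapping.lookup f e * monom_val e x)"
  unfolding eval_poly_def monom_val_def[symmetric]
  by (rule sum.mono_neutral_left) (use assms in \<open>auto simp: in_keys_iff\<close>)

lemma form_eval_poly:
  assumes "homogeneous_poly f" shows "\<exists>D. form D (eval_poly f)"
proof -
  obtain D where "Poly_Mapping.keys f \<subseteq> exps D"
    using assms unfolding homogeneous_poly_def exps_def by auto
  then show ?thesis unfolding form_def using eval_poly_superset[OF finite_exps] by blast
qed

lemma form_obtain_poly:
  assumes "form D g"
  obtains f where "homogeneous_poly f" "\<And>x. eval_poly f x = g x"
proof -
  obtain c where c: "\<And>x. g x = (\<Sum>e\<in>exps D. c e * monom_val e x)"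
    using assms unfolding form_def by blast
  define f where "f = (\<Sum>e\<in>exps D. Poly_Mapping.single e (c e))"
  have l: "Poly_Mapping.lookup f e = (if e \<in> exps D then c e else 0)" for e
    by (simp add: f_def lookup_sum lookup_single when_def sum.delta)
  have k: "Poly_Mapping.keys f \<subseteq> exps D" by (auto simp: in_keys_iff l split: if_splits)
  show ?thesis
  proof
    show "homogeneous_poly f" using k unfolding homogeneous_poly_def exps_def by blast
    show "eval_poly f x = g x" for x by (simp add: eval_poly_superset[OF finite_exps k] l c)
  qed
qed

section \<open>Zariski closed sets, hulls and irreducibility through forms\<close>

lemma zariski_closed_iff_forms:
  "zariski_closed Z \<longleftrightarrow> (\<exists>G. (\<forall>g\<in>G. \<exists>D. form D g) \<and> Z = {x. x \<noteq> 0 \<and> (\<forall>g\<in>G. g x = 0)})"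
proof
  assume "zariski_closed Z"
  then obtain F where F: "\<forall>f\<in>F. homogeneous_poly f" "Z = proj_zeros F"
    unfolding zariski_closed_def by blast
  then show "\<exists>G. (\<forall>g\<in>G. \<exists>D. form D g) \<and> Z = {x. x \<noteq> 0 \<and> (\<forall>g\<in>G. g x = 0)}"
    by (intro exI[of _ "eval_poly ` F"]) (auto simp: proj_zeros_def intro: form_eval_poly)
next
  assume "\<exists>G. (\<forall>g\<in>G. \<exists>D. form D g) \<and> Z = {x. x \<noteq> 0 \<and> (\<forall>g\<in>G. g x = 0)}"
  then obtain G where G: "\<forall>g\<in>G. \<exists>D. form D g" "Z = {x. x \<noteq> 0 \<and> (\<forall>g\<in>G. g x = 0)}" by blast
  have "\<exists>f. homogeneous_poly f \<and> eval_poly f = g" if "g \<in> G" for g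
    using G(1) that form_obtain_poly by (metis ext)
  then obtain p where p: "\<And>g. g \<in> G \<Longrightarrow> homogeneous_poly (p g) \<and> eval_poly (p g) = g" by metis
  have "Z = proj_zeros (p ` G)" unfolding G(2) proj_zeros_def using p by auto
  then show "zariski_closed Z" unfolding zariski_closed_def using p by blast
qed

lemma zariski_closed_obtain_form:
  assumes "zariski_closed Z" "x \<noteq> 0" "x \<notin> Z"
  obtains D g where "form D g" "\<And>z. z \<in> Z \<Longrightarrow> g z = 0" "g x \<noteq> 0"
proof -
  obtain G where G: "\<forall>g\<in>G. \<exists>D. form D g" "Z = {x. x \<noteq> 0 \<and> (\<forall>g\<in>G. g x = 0)}"
    using assms(1) unfolding zariski_closed_iff_forms by blast
  then obtain g where "g \<in> G" "g x \<noteq> 0" using assms by blast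
  with G that show ?thesis by blast
qed

lemma zariski_closed_nonzero: "zariski_closed Z \<Longrightarrow> x \<in> Z \<Longrightarrow> x \<noteq> 0"
  unfolding zariski_closed_iff_forms by blast

lemma zariski_closed_inter_form:
  assumes "zariski_closed Z" "form D f"
  shows "zariski_closed {x\<in>Z. f x = 0}"
proof -
  obtain G where "\<forall>g\<in>G. \<exists>D. form D g" "Z = {x. x \<noteq> 0 \<and> (\<forall>g\<in>G. g x = 0)}"
    using assms(1) unfolding zariski_closed_iff_forms by blast
  then show ?thesis
    unfolding zariski_closed_iff_forms using assms(2) by (intro exI[of _ "insert f G"]) auto
qed

text \<open>The right-hand side is closed, being cut out by the forms vanishing on \<open>S\<close>;
  a closed superset of \<open>S\<close> missing one of its points would supply a separating
  form.\<close>

lemma zariski_hull_eq: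
  fixes S :: "('k::comm_semiring_1^'n) set"
  assumes "0 \<notin> S"
  shows "zariski_closed hull S = {x. x \<noteq> 0 \<and> (\<forall>D g. form D g \<and> (\<forall>y\<in>S. g y = 0) \<longrightarrow> g x = 0)}" (is "_ = ?R")
proof
  have "zariski_closed ?R"
    unfolding zariski_closed_iff_forms
    by (intro exI[of _ "{g. \<exists>D. form D g \<and> (\<forall>y\<in>S. g y = 0)}"]) auto
  moreover have "S \<subseteq> ?R" using assms by auto
  ultimately show "zariski_closed hull S \<subseteq> ?R" by (intro hull_minimal)
  show "?R \<subseteq> zariski_closed hull S"
  proof
    fix x assume x: "x \<in> ?R"
    have "x \<in> t" if t: "zariski_closed t" "S \<subseteq> t" for t
    proof (rule ccontr)
      assume "x \<notin> t"
      with t x zariski_closed_obtain_form[of t x] show False by (smt (verit, best) mem_Collect_eq subsetD)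
    qed
    then show "x \<in> zariski_closed hull S" unfolding hull_def by blast
  qed
qed

lemma zariski_closed_hull:
  fixes S :: "('k::comm_semiring_1^'n) set"
  assumes "0 \<notin> S"
  shows "zariski_closed (zariski_closed hull S)"
  unfolding zariski_hull_eq[OF assms] zariski_closed_iff_forms
  by (intro exI[of _ "{g. \<exists>D. form D g \<and> (\<forall>y\<in>S. g y = 0)}"]) auto

text \<open>The loci \<open>f = 0\<close> and \<open>g = 0\<close> inside \<open>Z\<close> are
  closed and cover it; this is primality of the vanishing ideal.\<close>

lemma irreducible_closed_form:
  fixes Z :: "('k::field^'n) set"
  assumes Z: "irreducible_closed Z" and f: "form a f" and g: "form b g"
    and fg: "\<And>x. x \<in> Z \<Longrightarrow> f x * g x = 0"
  shows "(\<forall>x\<in>Z. f x = 0) \<or> (\<forall>x\<in>Z. g x = 0)"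
proof -
  have "zariski_closed Z" using Z by (simp add: irreducible_closed_def)
  then have "zariski_closed {x\<in>Z. f x = 0}" "zariski_closed {x\<in>Z. g x = 0}"
    using f g by (simp_all add: zariski_closed_inter_form)
  moreover have "Z = {x\<in>Z. f x = 0} \<union> {x\<in>Z. g x = 0}" using fg by auto
  ultimately have "Z = {x\<in>Z. f x = 0} \<or> Z = {x\<in>Z. g x = 0}"
    using Z unfolding irreducible_closed_def by blast
  then show ?thesis by blast
qed

text \<open>If two proper closed parts covered the hull, each would miss a point of
  \<open>S\<close>; the separating forms would be nonzero together at a point of \<open>S\<close> in
  neither part.\<close>

lemma irreducible_closed_hull:
  fixes S :: "('k::comm_semiring_1^'n) set"
  assumes "0 \<notin> S" "S \<noteq> {}"
    and S: "\<And>a f b g x y. form a f \<Longrightarrow> form b g \<Longrightarrow> x \<in> S \<Longrightarrow> f x \<noteq> 0 \<Longrightarrow> y \<in> S \<Longrightarrow> g y \<noteq> 0 \<Longrightarrow>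
        \<exists>z\<in>S. f z \<noteq> 0 \<and> g z \<noteq> 0"
  shows "irreducible_closed (zariski_closed hull S)"
  unfolding irreducible_closed_def
proof (intro conjI allI impI)
  let ?H = "zariski_closed hull S"
  show "zariski_closed ?H" by (rule zariski_closed_hull[OF assms(1)])
  show "?H \<noteq> {}" using assms(2) hull_subset[of S zariski_closed] by blast
  fix C D assume C: "zariski_closed C" and D: "zariski_closed D" and CD: "?H = C \<union> D"
  have SCD: "S \<subseteq> C \<union> D" using CD hull_subset[of S zariski_closed] by blast
  show "?H = C \<or> ?H = D"
  proof (rule ccontr)
    assume "\<not> (?H = C \<or> ?H = D)"
    then have "\<not> S \<subseteq> C" "\<not> S \<subseteq> D"
      using hull_minimal[of S C zariski_closed] hull_minimal[of S D zariski_closed] C D CD by auto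
    then obtain x y where xy: "x \<in> S" "x \<notin> C" "y \<in> S" "y \<notin> D" by blast
    then have nz: "x \<noteq> 0" "y \<noteq> 0" using assms(1) by auto
    obtain a f where f: "form a f" "\<And>z. z \<in> C \<Longrightarrow> f z = 0" "f x \<noteq> 0"
      using zariski_closed_obtain_form[OF C nz(1) xy(2)] by blast
    obtain b g where g: "form b g" "\<And>z. z \<in> D \<Longrightarrow> g z = 0" "g y \<noteq> 0"
      using zariski_closed_obtain_form[OF D nz(2) xy(4)] by blast
    obtain z where "z \<in> S" "f z \<noteq> 0" "g z \<noteq> 0" using S[OF f(1) g(1) xy(1) f(3) xy(3) g(3)] by blast
    with f g SCD show False by blast
  qed
qed

section \<open>Linear dependence of forms of a fixed degree\<close>

lemma linear_dependence:
  fixes M :: "'i \<Rightarrow> 'b \<Rightarrow> 'k::field"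
  assumes "finite B" "finite I" "card B < card I"
  shows "\<exists>c. (\<exists>k\<in>I. c k \<noteq> 0) \<and> (\<forall>b\<in>B. (\<Sum>k\<in>I. c k * M k b) = 0)"
  using assms
proof (induction B arbitrary: I M)
  case empty
  then have "I \<noteq> {}" by auto
  then show ?case by (intro exI[of _ "\<lambda>_. 1"]) auto
next
  case (insert b B)
  show ?case
  proof (cases "\<forall>k\<in>I. M k b = 0")
    case True
    then show ?thesis using insert.IH[of I M] insert by auto
  next
    case False
    then obtain p where p: "p \<in> I" "M p b \<noteq> 0" by blast
    define M' where "M' = (\<lambda>k b'. M k b' - M k b / M p b * M p b')"
    have "card B < card (I - {p})" using insert p by simp
    then obtain c where c: "\<exists>k\<in>I - {p}. c k \<noteq> 0" "\<And>b'. b' \<in> B \<Longrightarrow> (\<Sum>k\<in>I - {p}. c k * M' k b') = 0"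
      using insert.IH[of "I - {p}" M'] insert.prems by blast
    \<comment> \<open>Gaussian elimination with pivot row \<open>p\<close>: the coefficient
      \<open>- s\<close> at \<open>p\<close> accounts for all multiples of that row subtracted in
      \<open>M'\<close>.\<close>
    define s where "s = (\<Sum>k\<in>I - {p}. c k * M k b / M p b)"
    define c' where "c' = c(p := - s)"
    have sum: "(\<Sum>k\<in>I. c' k * M k b') = (\<Sum>k\<in>I - {p}. c k * M' k b')" for b'
    proof -
      have "(\<Sum>k\<in>I. c' k * M k b') = - s * M p b' + (\<Sum>k\<in>I - {p}. c k * M k b')"
        using p insert.prems by (simp add: sum.remove[of I p] c'_def)
      also have "\<dots> = (\<Sum>k\<in>I - {p}. c k * M' k b')"
        by (simp add: M'_def s_def sum_distrib_right right_diff_distrib sum_subtractf mult.assoc)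
      finally show ?thesis .
    qed
    have "(\<Sum>k\<in>I. c' k * M k b') = 0" if "b' \<in> insert b B" for b'
    proof (cases "b' = b")
      case True
      then show ?thesis unfolding sum using p(2) by (simp add: M'_def)
    next
      case False
      then show ?thesis unfolding sum using that c(2) by auto
    qed
    moreover have "\<exists>k\<in>I. c' k \<noteq> 0" using c(1) by (auto simp: c'_def)
    ultimately show ?thesis by blast
  qed
qed

lemma forms_dependent:
  fixes F :: "nat \<Rightarrow> 'k::field^'n \<Rightarrow> 'k"
  assumes "\<And>k. form D (F k)" "n > card (exps D :: (nat^'n) set)"
  shows "\<exists>c. (\<exists>k<n. c k \<noteq> 0) \<and> (\<forall>x. (\<Sum>k<n. c k * F k x) = 0)"
proof -
  have "\<forall>k. \<exists>a. \<forall>x. F k x = (\<Sum>e\<in>exps D. a e * monom_val e x)" using assms(1) unfolding form_def by blast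
  then obtain a where a: "\<And>k x. F k x = (\<Sum>e\<in>exps D. a k e * monom_val e x)" by metis
  obtain c where c: "\<exists>k<n. c k \<noteq> 0" "\<And>e. e \<in> exps D \<Longrightarrow> (\<Sum>k<n. c k * a k e) = 0"
    using linear_dependence[of "exps D :: (nat^'n) set" "{..<n}" a] assms(2) by auto
  have "(\<Sum>k<n. c k * F k x) = 0" for x
  proof -
    have "(\<Sum>k<n. c k * F k x) = (\<Sum>e\<in>exps D. \<Sum>k<n. c k * a k e * monom_val e x)"
      unfolding a sum_distrib_left by (subst sum.swap) (simp add: mult.assoc)
    also have "\<dots> = 0" by (simp add: c(2) flip: sum_distrib_right)
    finally show ?thesis .
  qed
  with c(1) show ?thesis by blast
qed

text \<open>
  For a form \<open>f\<close> vanishing on \<open>X\<close>, the pullbacks of \<open>f\<close> under the powers of \<open>L\<close> are linearly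
  dependent; composing the relation with a power of \<open>R\<close> expresses \<open>f \<circ> R\<close> through forms
  that vanish on \<open>X\<close>.
\<close>

lemma zariski_closed_inverse_invariant:
  fixes X :: "('k::field^'n) set"
  assumes X: "zariski_closed X" and L: "\<And>i. form 1 (\<lambda>x. L x $ i)"
    and LR: "\<And>x. L (R x) = x" and inv: "\<And>x. x \<in> X \<Longrightarrow> L x \<in> X"
    and x: "x \<in> X" "R x \<noteq> 0"
  shows "R x \<in> X"
proof (rule ccontr)
  assume "R x \<notin> X"
  then obtain D f where f: "form D f" "\<And>z. z \<in> X \<Longrightarrow> f z = 0" "f (R x) \<noteq> 0"
    using zariski_closed_obtain_form[OF X x(2)] by blast
  have Lform: "form 1 (\<lambda>x. (L ^^ k) x $ i)" for k i
  proof (induction k arbitrary: i)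
    case (Suc k)
    show ?case using form_subst[OF L[of i], of "L ^^ k"] Suc by simp
  qed (use form_coord in simp)
  obtain n c where n: "\<exists>k<n. c k \<noteq> 0" "\<And>x. (\<Sum>k<n. c k * f ((L ^^ k) x)) = 0"
    using forms_dependent[of D "\<lambda>k x. f ((L ^^ k) x)" "Suc (card (exps D :: (nat^'n) set))"]
      form_subst[OF f(1) Lform] by blast
  \<comment> \<open>The lowest power in the relation. At \<open>(R ^^ Suc m) x\<close> the terms
    above \<open>m\<close> are values of \<open>f\<close> on \<open>X\<close>, and term
    \<open>m\<close> is \<open>c m * f (R x)\<close>.\<close>
  define m where "m = (LEAST k. k < n \<and> c k \<noteq> 0)"
  have m: "m < n" "c m \<noteq> 0" using LeastI_ex[OF n(1)] by (auto simp: m_def)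
  have less: "c k = 0" if "k < m" for k
    using not_less_Least[of k "\<lambda>k. k < n \<and> c k \<noteq> 0"] that m(1) by (auto simp: m_def)
  have LRk: "(L ^^ k) ((R ^^ k) y) = y" for k y
    by (induction k arbitrary: y) (simp_all add: LR funpow_swap1)
  have Lk: "(L ^^ k) x \<in> X" for k by (induction k) (auto intro: inv x)
  have gt: "f ((L ^^ k) ((R ^^ Suc m) x)) = 0" if "k > m" for k
  proof -
    obtain d where "k = d + Suc m" using \<open>k > m\<close> by (metis add.commute less_imp_Suc_add add_Suc_right)
    then have "(L ^^ k) ((R ^^ Suc m) x) = (L ^^ d) x"
      by (simp only: funpow_add o_apply LRk)
    then show ?thesis using f(2) Lk by simp
  qed
  have eq: "(L ^^ m) ((R ^^ Suc m) x) = R x"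
    using LRk[of m "R x"] by (simp add: funpow_swap1)
  have "(\<Sum>k<n. c k * f ((L ^^ k) ((R ^^ Suc m) x))) = (\<Sum>k<n. if k = m then c m * f (R x) else 0)"
    by (rule sum.cong) (use less gt eq in \<open>auto simp del: funpow.simps simp: not_less_iff_gr_or_eq elim: linorder_neqE_nat\<close>)
  then show False using n(2) m f(3) by (simp add: sum.delta)
qed


section \<open>Coordinates on the lattice\<close>

text \<open>The kernel is orthogonal to the rows of \<open>A\<close>, hence to their span, which
  contains the all-ones vector.\<close>

lemma int_kernel_sum_zero:
  assumes "ones_in_row_span A" "u \<in> int_kernel A"
  shows "(\<Sum>i\<in>UNIV. u $ i) = 0"
proof -
  have "(\<Sum>i\<in>UNIV. of_int (u $ i) * v $ i) = 0"
    if "v \<in> vec.span (rows (map_matrix of_int A :: rat^'a^'b))" for v :: "rat^'a"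
    using that
  proof (induction rule: vec.span_induct_alt)
    case (step c x y)
    then obtain k where k: "x = row k (map_matrix of_int A)" unfolding rows_def by auto
    have "(\<Sum>i\<in>UNIV. of_int (u $ i) * x $ i) = (of_int (\<Sum>i\<in>UNIV. A $ k $ i * u $ i) :: rat)"
      by (simp add: k row_def mult.commute)
    also have "\<dots> = 0" using assms(2) by (simp add: int_kernel_iff)
    finally show ?case
      using step by (simp add: algebra_simps sum.distrib flip: sum_distrib_left)
  qed simp
  from this[of "\<chi> j. 1"] assms(1) have "of_int (\<Sum>i\<in>UNIV. u $ i) = (0 :: rat)"
    by (simp add: ones_in_row_span_def)
  then show ?thesis by (simp only: of_int_eq_0_iff)
qed

text \<open>
  The columns indexed by \<open>J\<close> form a rational basis of the column space, and
  \<open>N \<cdot> a\<^sub>i = (\<Sum>j\<in>J. w j i \<cdot> a\<^sub>j)\<close> for every column \<open>a\<^sub>i\<close>.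
\<close>

locale column_basis =
  fixes A :: "int^'n^'m" and J :: "'n set" and N :: int and w :: "'n \<Rightarrow> 'n \<Rightarrow> int"
  assumes N_pos: "N > 0"
    and w_diag: "\<And>i j. i \<in> J \<Longrightarrow> j \<in> J \<Longrightarrow> w j i = (if i = j then N else 0)"
    and kernel_iff: "\<And>u. u \<in> int_kernel A \<longleftrightarrow> (\<forall>j\<in>J. (\<Sum>i\<in>UNIV. w j i * u $ i) = 0)"
    and w_sum: "\<And>i. (\<Sum>j\<in>J. w j i) = N"

text \<open>Let \<open>J\<close> be maximal among the index sets supporting no nonzero kernel
  vector. For \<open>i\<close> outside \<open>J\<close>, a kernel vector supported on
  \<open>insert i J\<close> then expresses column \<open>i\<close> through the columns in
  \<open>J\<close>.\<close>

lemma column_basis_exists: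
  fixes A :: "int^'n^'m"
  assumes ones: "ones_in_row_span A"
  shows "\<exists>J N w. column_basis A J N w"
proof -
  define indep where "indep = (\<lambda>J. \<forall>u\<in>int_kernel A. (\<forall>i. i \<notin> J \<longrightarrow> u $ i = 0) \<longrightarrow> u = 0)"
  have "indep {}" by (simp add: indep_def vec_eq_iff)
  then obtain J where J: "indep J" and Jmax: "\<And>J'. indep J' \<Longrightarrow> J \<subseteq> J' \<Longrightarrow> J = J'"
    using finite_has_maximal[of "Collect indep"] by auto
  have "\<exists>u\<in>int_kernel A. (\<forall>k. k \<notin> J \<longrightarrow> k \<noteq> i \<longrightarrow> u $ k = 0) \<and> u $ i \<noteq> 0" if "i \<notin> J" for i
  proof -
    have "\<not> indep (insert i J)" using Jmax[of "insert i J"] that by blast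
    then obtain u where u: "u \<in> int_kernel A" "\<forall>k. k \<notin> insert i J \<longrightarrow> u $ k = 0" "u \<noteq> 0"
      unfolding indep_def by blast
    have "u $ i \<noteq> 0"
    proof
      assume "u $ i = 0"
      with u(2) have "\<forall>k. k \<notin> J \<longrightarrow> u $ k = 0" by (metis insert_iff)
      with J u show False unfolding indep_def by blast
    qed
    with u show ?thesis by blast
  qed
  then obtain y where y: "\<And>i. i \<notin> J \<Longrightarrow> y i \<in> int_kernel A" "\<And>i k. i \<notin> J \<Longrightarrow> k \<notin> J \<Longrightarrow> k \<noteq> i \<Longrightarrow> y i $ k = 0"
    "\<And>i. i \<notin> J \<Longrightarrow> y i $ i \<noteq> 0" by metis
  \<comment> \<open>A common multiple of the entries \<open>y i $ i\<close>, so that every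
    \<open>y i\<close> can be rescaled over the integers to have entry \<open>N\<close> at
    \<open>i\<close>.\<close>
  define N where "N = (\<Prod>i\<in>- J. \<bar>y i $ i\<bar>)"
  define z where "z = (\<lambda>i. (N div (y i $ i)) *s y i)"
  have N: "N > 0" unfolding N_def by (rule prod_pos) (use y in auto)
  have z: "z i \<in> int_kernel A" "\<And>k. k \<notin> J \<Longrightarrow> z i $ k = (if k = i then N else 0)" if i: "i \<notin> J" for i
  proof -
    show "z i \<in> int_kernel A" unfolding z_def using y(1)[OF i] by (rule int_kernel_scale)
    have "\<bar>y i $ i\<bar> dvd N" unfolding N_def using i by (intro dvd_prodI) auto
    then have "N div (y i $ i) * y i $ i = N" by simp
    then show "z i $ k = (if k = i then N else 0)" if "k \<notin> J" for k
      using y(2)[OF i that] by (auto simp: z_def)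
  qed
  \<comment> \<open>The minus sign moves the columns of \<open>J\<close> to the other side of the
    relation \<open>z i\<close>.\<close>
  define w where "w = (\<lambda>j i. if i \<in> J then if i = j then N else 0 else - z i $ j)"
  \<comment> \<open>Subtracting kernel vectors clears the coordinates outside \<open>J\<close>; the
    rest is in the kernel only if it is zero, which turns membership into equations in
    \<open>w\<close>.\<close>
  define red where "red = (\<lambda>u. N *s u - (\<Sum>i\<in>- J. u $ i *s z i))"
  have red_out: "red u $ k = 0" if "k \<notin> J" for u k
  proof -
    have "(\<Sum>i\<in>- J. u $ i * z i $ k) = (\<Sum>i\<in>- J. if i = k then u $ i * N else 0)"
      by (rule sum.cong) (use z(2) that in auto)
    then show ?thesis using that by (simp add: red_def)
  qed
  have red_in: "red u $ j = (\<Sum>i\<in>UNIV. w j i * u $ i)" if "j \<in> J" for u j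
  proof -
    have "(\<Sum>i\<in>UNIV. w j i * u $ i) = (\<Sum>i\<in>J. w j i * u $ i) + (\<Sum>i\<in>- J. w j i * u $ i)"
      by (subst sum.union_disjoint[symmetric]) (auto simp: Compl_partition)
    also have "(\<Sum>i\<in>J. w j i * u $ i) = (\<Sum>i\<in>J. if i = j then N * u $ i else 0)"
      by (rule sum.cong) (auto simp: w_def)
    also have "\<dots> = N * u $ j" using that by simp
    also have "(\<Sum>i\<in>- J. w j i * u $ i) = - (\<Sum>i\<in>- J. u $ i * z i $ j)"
      by (simp add: w_def sum_negf mult.commute)
    finally show ?thesis by (simp add: red_def)
  qed
  have zsum: "(\<Sum>i\<in>- J. u $ i *s z i) \<in> int_kernel A" for u
    by (intro int_kernel_sum int_kernel_scale z) auto
  have ker: "u \<in> int_kernel A \<longleftrightarrow> (\<forall>j\<in>J. (\<Sum>i\<in>UNIV. w j i * u $ i) = 0)" for u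
  proof -
    have "u \<in> int_kernel A \<longleftrightarrow> red u \<in> int_kernel A"
    proof
      assume "red u \<in> int_kernel A"
      from int_kernel_add[OF this zsum[of u]] have "N *s u \<in> int_kernel A" by (simp add: red_def)
      with N show "u \<in> int_kernel A" using int_kernel_saturated by blast
    qed (auto simp: red_def intro!: int_kernel_diff int_kernel_scale zsum)
    also have "\<dots> \<longleftrightarrow> red u = 0"
      using J red_out unfolding indep_def by auto
    also have "\<dots> \<longleftrightarrow> (\<forall>j\<in>J. red u $ j = 0)"
      using red_out by (auto simp: vec_eq_iff)
    finally show ?thesis by (simp add: red_in)
  qed
  \<comment> \<open>Homogeneity enters here: the coordinates of the kernel vector \<open>z i\<close>
    sum to zero.\<close>
  have wsum: "(\<Sum>j\<in>J. w j i) = N" for i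
  proof (cases "i \<in> J")
    case False
    have "0 = (\<Sum>k\<in>UNIV. z i $ k)" using int_kernel_sum_zero[OF ones z(1)[OF False]] by simp
    also have "\<dots> = (\<Sum>k\<in>J. z i $ k) + (\<Sum>k\<in>- J. z i $ k)"
      by (subst sum.union_disjoint[symmetric]) (auto simp: Compl_partition)
    also have "(\<Sum>k\<in>- J. z i $ k) = (\<Sum>k\<in>- J. if k = i then N else 0)"
      by (rule sum.cong) (use z(2) False in auto)
    also have "\<dots> = N" using False by simp
    finally show ?thesis using False by (simp add: w_def sum_negf)
  qed (simp add: w_def)
  have "column_basis A J N w"
    by standard (use N ker wsum in \<open>auto simp: w_def\<close>)
  then show ?thesis by blast
qed

text \<open>Among the vectors \<open>c * v + v'\<close> each index excludes at most one integer
  \<open>c\<close>, so some \<open>c\<close> avoids all of them.\<close>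

lemma avoid_zeros:
  fixes V :: "('i \<Rightarrow> int) set"
  assumes add: "\<And>v v' c. v \<in> V \<Longrightarrow> v' \<in> V \<Longrightarrow> (\<lambda>i. c * v i + v' i) \<in> V"
    and zero: "(\<lambda>_. 0) \<in> V"
    and "finite I" "\<And>i. i \<in> I \<Longrightarrow> \<exists>v\<in>V. v i \<noteq> 0"
  shows "\<exists>v\<in>V. \<forall>i\<in>I. v i \<noteq> 0"
  using assms(3,4)
proof (induction I)
  case empty
  then show ?case using zero by blast
next
  case (insert j I)
  then obtain v v' where v: "v \<in> V" "\<forall>i\<in>I. v i \<noteq> 0" and v': "v' \<in> V" "v' j \<noteq> 0" by (metis insert_iff)
  define bad where "bad = (\<lambda>i. {c. c * v i + v' i = 0})"
  have "finite (bad i)" if "v i \<noteq> 0 \<or> v' i \<noteq> 0" for i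
  proof (rule finite_subset)
    show "bad i \<subseteq> {- v' i div v i}"
      using that by (auto simp: bad_def add_eq_0_iff)
  qed simp
  then have "finite (\<Union>i\<in>insert j I. bad i)" using insert.hyps v v' by auto
  then obtain c where "c \<notin> (\<Union>i\<in>insert j I. bad i)"
    using ex_new_if_finite infinite_UNIV_int by blast
  then have "\<forall>i\<in>insert j I. c * v i + v' i \<noteq> 0" by (auto simp: bad_def)
  then show ?case using add[OF v(1) v'(1)] by (intro bexI[of _ "\<lambda>i. c * v i + v' i"])
qed


section \<open>The toric variety and its vanishing forms\<close>

lemma eval_poly_add: "eval_poly (f + g) x = eval_poly f x + eval_poly g x"
proof -
  let ?E = "Poly_Mapping.keys f \<union> Poly_Mapping.keys g"
  have "Poly_Mapping.keys (f + g) \<subseteq> ?E" by (rule Poly_Mapping.keys_add)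
  then show ?thesis
    by (simp add: eval_poly_superset[of ?E] lookup_add algebra_simps sum.distrib)
qed

lemma eval_poly_single: "eval_poly (Poly_Mapping.single e c) x = c * monom_val e x"
  by (cases "c = 0") (simp_all add: eval_poly_def monom_val_def)

lemma eval_poly_sum: "eval_poly (\<Sum>i\<in>I. f i) x = (\<Sum>i\<in>I. eval_poly (f i) x)"
  by (induction I rule: infinite_finite_induct) (simp_all add: eval_poly_add, simp_all add: eval_poly_def)

lemma eval_poly_mult: "eval_poly (f * g) x = eval_poly f x * eval_poly g x"
proof -
  have "eval_poly (f * g) x =
      eval_poly (\<Sum>a\<in>Poly_Mapping.keys f. \<Sum>b\<in>Poly_Mapping.keys g.
        Poly_Mapping.single (a + b) (Poly_Mapping.lookup f a * Poly_Mapping.lookup g b)) x"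
    by (subst poly_sum_single[of f], subst poly_sum_single[of g]) (simp add: sum_product mult_single)
  also have "\<dots> = eval_poly f x * eval_poly g x"
    unfolding eval_poly_sum eval_poly_single monom_val_add
      eval_poly_superset[OF finite_keys order_refl, of f] eval_poly_superset[OF finite_keys order_refl, of g]
    by (simp add: sum_product algebra_simps)
  finally show ?thesis .
qed

lemma eval_toric_binomial:
  fixes x :: "'k::comm_ring_1^'n"
  shows "eval_poly (toric_binomial u) x = monom_val (pos_part u) x - monom_val (neg_part u) x"
proof -
  have "(toric_binomial u :: ('k, 'n) polynomials) = Poly_Mapping.single (pos_part u) 1 + Poly_Mapping.single (neg_part u) (- 1)"
    by (simp add: toric_binomial_def single_uminus)
  then show ?thesis by (simp only: eval_poly_add eval_poly_single) simp
qed

lemma toric_variety_iff: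
  "x \<in> toric_variety A \<longleftrightarrow>
     x \<noteq> 0 \<and> (\<forall>u\<in>int_kernel A. monom_val (pos_part u) x = monom_val (neg_part u) x)"
proof -
  have "eval_poly f x = 0"
    if "\<forall>u\<in>int_kernel A. monom_val (pos_part u) x = monom_val (neg_part u) x" "f \<in> toric_ideal A" for f
    using that(2) unfolding toric_ideal_def
  proof (induction rule: ideal_generated_induct)
    case (step c f g)
    then have "eval_poly f x = 0" using that(1) by (auto simp: eval_toric_binomial)
    with step show ?case by (simp add: eval_poly_add eval_poly_mult)
  qed (simp add: eval_poly_def)
  moreover have "monom_val (pos_part u) x = monom_val (neg_part u) x"
    if "\<forall>f\<in>toric_ideal A. eval_poly f x = 0" "u \<in> int_kernel A" for u
  proof -
    have "toric_binomial u \<in> toric_ideal A"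
      unfolding toric_ideal_def using that(2) by (intro ideal_generated_base) simp
    with that(1) have "eval_poly (toric_binomial u) x = 0" by blast
    then show ?thesis by (simp add: eval_toric_binomial)
  qed
  ultimately show ?thesis unfolding toric_variety_def proj_zeros_def by blast
qed

lemma monom_val_nonzero: "(\<And>i. x $ i \<noteq> 0) \<Longrightarrow> monom_val e x \<noteq> (0 :: 'k::field)"
  by (simp add: monom_val_def)

section \<open>Multidegree classes of exponents and density of the torus\<close>

context column_basis
begin

text \<open>\<open>N\<close> times the \<open>j\<close>-th coordinate of the multidegree
  \<open>A e\<close> in the basis of columns from \<open>J\<close>; hence \<open>equiv_exp\<close>
  is equality of multidegrees.\<close>

definition weight :: "'n \<Rightarrow> nat^'n \<Rightarrow> int" where
  "weight j e = (\<Sum>i\<in>UNIV. w j i * int (e $ i))"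

definition equiv_exp :: "nat^'n \<Rightarrow> nat^'n \<Rightarrow> bool" where
  "equiv_exp e e' \<longleftrightarrow> (\<forall>j\<in>J. weight j e = weight j e')"

lemma equiv_exp_iff_kernel: "equiv_exp e e' \<longleftrightarrow> (\<chi> i. int (e $ i) - int (e' $ i)) \<in> int_kernel A"
  by (simp add: equiv_exp_def kernel_iff weight_def right_diff_distrib sum_subtractf)

lemma weight_sum: "(\<Sum>j\<in>J. weight j e) = N * int (\<Sum>i\<in>UNIV. e $ i)"
  unfolding weight_def by (subst sum.swap) (simp add: w_sum sum_distrib_left flip: sum_distrib_right)

lemma equiv_exp_degree: "equiv_exp e e' \<Longrightarrow> (\<Sum>i\<in>UNIV. e $ i) = (\<Sum>i\<in>UNIV. e' $ i)"
proof -
  assume "equiv_exp e e'"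
  then have "(\<Sum>j\<in>J. weight j e) = (\<Sum>j\<in>J. weight j e')" by (simp add: equiv_exp_def)
  then show ?thesis unfolding weight_sum using N_pos by (metis mult_cancel_left of_nat_eq_iff less_irrefl)
qed

lemma equiv_exp_parts:
  assumes "u \<in> int_kernel A" shows "equiv_exp (pos_part u) (neg_part u)"
  unfolding equiv_exp_iff_kernel pos_neg_parts using assms by simp

text \<open>After cancelling their coordinatewise minimum, two equivalent exponents are the positive
  and negative part of a kernel vector.\<close>

lemma toric_variety_iff_equiv:
  "x \<in> toric_variety A \<longleftrightarrow> x \<noteq> 0 \<and> (\<forall>e e'. equiv_exp e e' \<longrightarrow> monom_val e x = monom_val e' x)"
proof -
  have "monom_val e x = monom_val e' x"
    if X: "\<forall>u\<in>int_kernel A. monom_val (pos_part u) x = monom_val (neg_part u) x" and e: "equiv_exp e e'" for e e'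
  proof -
    define u where "u = (\<chi> i. int (e $ i) - int (e' $ i))"
    define m where "m = (\<chi> i. min (e $ i) (e' $ i))"
    have "e = pos_part u + m" "e' = neg_part u + m"
      by (auto simp: vec_eq_iff pos_part_def neg_part_def u_def m_def min_def)
    moreover have "u \<in> int_kernel A" using e by (simp add: u_def equiv_exp_iff_kernel)
    ultimately show ?thesis using X by (simp add: monom_val_add)
  qed
  then show ?thesis unfolding toric_variety_iff using equiv_exp_parts by blast
qed

lemma zariski_closed_toric_variety: "zariski_closed (toric_variety A :: ('k::comm_ring_1^'n) set)"
  unfolding zariski_closed_iff_forms
proof (intro exI conjI)
  define b where "b = (\<lambda>(u::int^'n) (x::'k^'n). monom_val (pos_part u) x - monom_val (neg_part u) x)"
  show "toric_variety A = {x :: 'k^'n. x \<noteq> 0 \<and> (\<forall>g\<in>b ` int_kernel A. g x = 0)}"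
    by (auto simp: toric_variety_iff b_def)
  show "\<forall>g\<in>b ` int_kernel A. \<exists>D. form D g"
  proof
    fix g assume "g \<in> b ` int_kernel A"
    then obtain u where u: "u \<in> int_kernel A" "g = b u" by blast
    let ?D = "\<Sum>i\<in>UNIV. pos_part u $ i"
    have "pos_part u \<in> exps ?D" "neg_part u \<in> exps ?D"
      using equiv_exp_degree[OF equiv_exp_parts[OF u(1)]] by (simp_all add: exps_def)
    then have "form ?D (\<lambda>x. monom_val (pos_part u) x + (- 1) * (monom_val (neg_part u) x :: 'k))"
      by (intro form_add form_scale form_monom)
    then show "\<exists>D. form D g" unfolding u(2) b_def by auto
  qed
qed

text \<open>Concerns the curve with coordinates \<open>t ^ \<omega> i\<close>: the second condition
  places it in the toric variety for nonzero \<open>t\<close>, the first gives distinct classes of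
  degree \<open>D\<close> distinct powers of \<open>t\<close>.\<close>

definition separates :: "nat \<Rightarrow> ('n \<Rightarrow> nat) \<Rightarrow> bool" where
  "separates D \<omega> \<longleftrightarrow>
    (\<forall>e\<in>exps D. \<forall>e'\<in>exps D.
      (\<Sum>i\<in>UNIV. \<omega> i * e $ i) = (\<Sum>i\<in>UNIV. \<omega> i * e' $ i) \<longrightarrow> equiv_exp e e') \<and>
    (\<forall>e e'. equiv_exp e e' \<longrightarrow> (\<Sum>i\<in>UNIV. \<omega> i * e $ i) = (\<Sum>i\<in>UNIV. \<omega> i * e' $ i))"

text \<open>Only finitely many pairs of inequivalent exponents of degree \<open>D\<close> have to be
  told apart, so a suitable integer combination of the weights does it.\<close>

lemma separating_weight: "\<exists>\<omega>. separates D \<omega>"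
proof -
  define P where "P = {(e, e'). e \<in> exps D \<and> e' \<in> exps D \<and> \<not> equiv_exp e e'}"
  define val where "val = (\<lambda>m (e, e'). \<Sum>j\<in>J. m j * (weight j e - weight j e'))"
  have "finite P" by (rule finite_subset[of _ "exps D \<times> exps D"]) (auto simp: P_def)
  have "\<exists>v\<in>range val. \<forall>p\<in>P. v p \<noteq> 0"
  proof (rule avoid_zeros[OF _ _ \<open>finite P\<close>])
    show "(\<lambda>_. 0) \<in> range val"
      by (rule range_eqI[of _ _ "\<lambda>_. 0"]) (auto simp: val_def)
    show "(\<lambda>i. c * v i + v' i) \<in> range val" if vv: "v \<in> range val" "v' \<in> range val" for v v' c
    proof -
      obtain m m' where "v = val m" "v' = val m'" using vv by blast
      then have "(\<lambda>i. c * v i + v' i) = val (\<lambda>j. c * m j + m' j)"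
        by (auto simp: val_def fun_eq_iff sum_distrib_left sum.distrib distrib_right mult.assoc)
      then show ?thesis by blast
    qed
    fix p assume "p \<in> P"
    then obtain e e' j where p: "p = (e, e')" "j \<in> J" "weight j e \<noteq> weight j e'"
      by (auto simp: P_def equiv_exp_def)
    have "val (\<lambda>k. if k = j then 1 else 0) p = weight j e - weight j e'"
      using p by (simp add: val_def if_distrib[of "\<lambda>c. c * _"] sum.delta cong: if_cong)
    then show "\<exists>v\<in>range val. v p \<noteq> 0" using p by (metis rangeI right_minus_eq)
  qed
  then obtain m where m: "\<And>p. p \<in> P \<Longrightarrow> val m p \<noteq> 0" by blast
  define b where "b = (\<lambda>i. \<Sum>j\<in>J. m j * w j i)"
  \<comment> \<open>Adding \<open>C\<close> to every entry makes the weights nonnegative and changes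
    values by \<open>C\<close> times the degree, which agrees on both sides of each
    comparison.\<close>
  define C where "C = (\<Sum>i\<in>UNIV. \<bar>b i\<bar>)"
  have pos: "b i + C \<ge> 0" for i
    using member_le_sum[of i UNIV "\<lambda>i. \<bar>b i\<bar>"] unfolding C_def by fastforce
  define \<omega> where "\<omega> = (\<lambda>i. nat (b i + C))"
  have omega: "int (\<Sum>i\<in>UNIV. \<omega> i * e $ i) = (\<Sum>j\<in>J. m j * weight j e) + C * int (\<Sum>i\<in>UNIV. e $ i)" for e
  proof -
    have "int (\<Sum>i\<in>UNIV. \<omega> i * e $ i) = (\<Sum>i\<in>UNIV. b i * int (e $ i)) + C * int (\<Sum>i\<in>UNIV. e $ i)"
      using pos by (simp add: \<omega>_def algebra_simps sum.distrib sum_distrib_left)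
    also have "(\<Sum>i\<in>UNIV. b i * int (e $ i)) = (\<Sum>j\<in>J. m j * weight j e)"
      unfolding b_def weight_def sum_distrib_right sum_distrib_left
      by (subst sum.swap) (simp add: mult.assoc)
    finally show ?thesis .
  qed
  have 1: "(\<Sum>i\<in>UNIV. \<omega> i * e $ i) = (\<Sum>i\<in>UNIV. \<omega> i * e' $ i)" if "equiv_exp e e'" for e e'
  proof -
    have "int (\<Sum>i\<in>UNIV. \<omega> i * e $ i) = int (\<Sum>i\<in>UNIV. \<omega> i * e' $ i)"
      unfolding omega equiv_exp_degree[OF that] using that by (simp add: equiv_exp_def)
    then show ?thesis by (simp only: of_nat_eq_iff)
  qed
  have 2: "equiv_exp e e'" if eq: "(\<Sum>i\<in>UNIV. \<omega> i * e $ i) = (\<Sum>i\<in>UNIV. \<omega> i * e' $ i)"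
    and D: "e \<in> exps D" "e' \<in> exps D" for e e'
  proof (rule ccontr)
    assume "\<not> equiv_exp e e'"
    then have "val m (e, e') \<noteq> 0" using m D by (simp add: P_def)
    moreover have "int (\<Sum>i\<in>UNIV. \<omega> i * e $ i) = int (\<Sum>i\<in>UNIV. \<omega> i * e' $ i)" using eq by simp
    then have "val m (e, e') = 0"
      unfolding omega using D by (simp del: of_nat_sum add: exps_def val_def right_diff_distrib sum_subtractf)
    ultimately show False by simp
  qed
  have "separates D \<omega>"
    unfolding separates_def by (intro conjI ballI allI impI) (rule 2, assumption+, rule 1, assumption)
  then show ?thesis by blast
qed

text \<open>
  A one-parameter subgroup separating the classes of exponents turns a vanishing form into a
  vanishing univariate polynomial.
\<close>

lemma vanishing_class_sum:
  fixes c :: "nat^'n \<Rightarrow> 'k::field_char_0"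
  assumes van: "\<And>x. x \<in> toric_variety A \<Longrightarrow> (\<And>i. x $ i \<noteq> 0) \<Longrightarrow> (\<Sum>e\<in>exps D. c e * monom_val e x) = 0"
    and \<phi>: "\<And>e e'. equiv_exp e e' \<Longrightarrow> \<phi> e = \<phi> e'"
  shows "(\<Sum>e\<in>exps D. c e * \<phi> e) = 0"
proof -
  obtain \<omega> where "separates D \<omega>" using separating_weight by blast
  then have \<omega>:
    "\<And>e e'. e \<in> exps D \<Longrightarrow> e' \<in> exps D \<Longrightarrow>
      (\<Sum>i\<in>UNIV. \<omega> i * e $ i) = (\<Sum>i\<in>UNIV. \<omega> i * e' $ i) \<Longrightarrow> equiv_exp e e'"
    "\<And>e e'. equiv_exp e e' \<Longrightarrow> (\<Sum>i\<in>UNIV. \<omega> i * e $ i) = (\<Sum>i\<in>UNIV. \<omega> i * e' $ i)"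
    unfolding separates_def by blast+
  define k where "k = (\<lambda>e :: nat^'n. \<Sum>i\<in>UNIV. \<omega> i * e $ i)"
  define F where "F = (\<Sum>e\<in>exps D. monom (c e) (k e))"
  have "poly F t = 0" if t: "t \<noteq> 0" for t
  proof -
    define x :: "'k^'n" where "x = (\<chi> i. t ^ \<omega> i)"
    have mon: "monom_val e x = t ^ k e" for e
      by (simp add: monom_val_def x_def k_def power_mult power_sum flip: power_mult)
    have nz: "x $ i \<noteq> 0" for i using t by (simp add: x_def)
    then have "x \<noteq> 0" by (metis zero_index)
    moreover have "k e = k e'" if "equiv_exp e e'" for e e'
      unfolding k_def using that by (rule \<omega>(2))
    ultimately have "x \<in> toric_variety A" unfolding toric_variety_iff_equiv mon by metis
    from van[OF this nz] show ?thesis by (simp add: F_def poly_sum poly_monom mon)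
  qed
  then have "UNIV - {0} \<subseteq> {t. poly F t = 0}" by auto
  moreover have "infinite (UNIV - {0 :: 'k})" by (simp add: infinite_UNIV_char_0)
  ultimately have "F = 0" using poly_roots_finite finite_subset by blast
  then have "coeff F n = 0" for n by simp
  \<comment> \<open>The exponents of degree \<open>D\<close> with a given value of \<open>k\<close>
    form one class, on which \<open>\<phi>\<close> is constant.\<close>
  then have coeff: "(\<Sum>e\<in>{e \<in> exps D. k e = n}. c e) = 0" for n
    by (simp add: F_def coeff_sum sum.inter_filter)
  have "(\<Sum>e\<in>exps D. c e * \<phi> e) = (\<Sum>n\<in>k ` exps D. \<Sum>e\<in>{e \<in> exps D. k e = n}. c e * \<phi> e)"
    by (rule sum.group[symmetric]) auto
  also have "\<dots> = 0"
  proof (rule sum.neutral, rule ballI)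
    fix n assume "n \<in> k ` exps D"
    then obtain e0 where e0: "e0 \<in> exps D" "k e0 = n" by blast
    have "(\<Sum>e\<in>{e \<in> exps D. k e = n}. c e * \<phi> e) = (\<Sum>e\<in>{e \<in> exps D. k e = n}. c e * \<phi> e0)"
      by (rule sum.cong) (use \<omega>(1) e0 \<phi> in \<open>auto simp: k_def\<close>)
    also have "\<dots> = 0" by (simp add: coeff flip: sum_distrib_right)
    finally show "(\<Sum>e\<in>{e \<in> exps D. k e = n}. c e * \<phi> e) = 0" .
  qed
  finally show ?thesis .
qed

text \<open>Density of the torus points: at any point \<open>x\<close> of the variety the monomial
  values are constant on classes, so they can serve as \<open>\<phi>\<close> in
  \<open>vanishing_class_sum\<close>.\<close>

lemma form_vanishes_toric_variety:
  fixes f :: "'k::field_char_0^'n \<Rightarrow> 'k"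
  assumes "form D f" "\<And>x. x \<in> toric_variety A \<Longrightarrow> (\<And>i. x $ i \<noteq> 0) \<Longrightarrow> f x = 0"
    and x: "x \<in> toric_variety A"
  shows "f x = 0"
proof -
  obtain c where c: "\<And>x. f x = (\<Sum>e\<in>exps D. c e * monom_val e x)"
    using assms unfolding form_def by blast
  show ?thesis unfolding c
    by (rule vanishing_class_sum) (use assms(2) x in \<open>auto simp: c toric_variety_iff_equiv\<close>)
qed


end


section \<open>Tangent spaces at torus points\<close>

lemma eval_partial_deriv:
  fixes x :: "'k::field^'n"
  assumes "x $ i \<noteq> 0" "finite E" "Poly_Mapping.keys f \<subseteq> E"
  shows "eval_poly (partial_deriv i f) x =
    (\<Sum>e\<in>E. Poly_Mapping.lookup f e * monom_val e x * (of_nat (e $ i) / x $ i))"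
proof -
  \<comment> \<open>If \<open>e $ i = 0\<close>, truncated subtraction leaves \<open>e\<close>
    unchanged, but the factor \<open>e $ i\<close> removes the term.\<close>
  have mon: "of_nat (e $ i) * monom_val (e - axis i 1) x = monom_val e x * (of_nat (e $ i) / x $ i)" for e
  proof (cases "e $ i = 0")
    case False
    then have "e = (e - axis i 1) + axis i 1" by (auto simp: vec_eq_iff axis_def)
    then have "monom_val e x = monom_val (e - axis i 1) x * x $ i"
      using monom_val_add[of "e - axis i 1" "axis i 1" x] by (simp add: monom_val_axis[unfolded One_nat_def])
    then show ?thesis using assms(1) by (simp add: field_simps)
  qed simp
  have "eval_poly (partial_deriv i f) x =
      (\<Sum>e\<in>Poly_Mapping.keys f. Poly_Mapping.lookup f e * (of_nat (e $ i) * monom_val (e - axis i 1) x))"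
    by (simp add: partial_deriv_def eval_poly_sum eval_poly_single algebra_simps)
  also have "\<dots> = (\<Sum>e\<in>E. Poly_Mapping.lookup f e * (of_nat (e $ i) * monom_val (e - axis i 1) x))"
    by (rule sum.mono_neutral_left) (use assms in \<open>auto simp: in_keys_iff\<close>)
  finally show ?thesis by (simp only: mon mult.assoc)
qed

lemma directional_deriv:
  fixes x v :: "'k::field^'n"
  assumes "\<And>i. x $ i \<noteq> 0" "finite E" "Poly_Mapping.keys f \<subseteq> E"
  shows "(\<Sum>i\<in>UNIV. eval_poly (partial_deriv i f) x * v $ i) =
    (\<Sum>e\<in>E. Poly_Mapping.lookup f e * (monom_val e x * (\<Sum>i\<in>UNIV. of_nat (e $ i) * (v $ i / x $ i))))"
  unfolding eval_partial_deriv[OF assms] sum_distrib_left sum_distrib_right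
  by (subst sum.swap) (simp add: algebra_simps)

context column_basis
begin

text \<open>The two monomials of the binomial of \<open>u\<close> agree at \<open>x\<close>, so its
  derivative is their common nonzero value times the pairing of \<open>u\<close> with
  \<open>v / x\<close>.\<close>

lemma tangent_space_kernel:
  fixes x v :: "'k::field^'n"
  assumes x: "x \<in> toric_variety A" "\<And>i. x $ i \<noteq> 0" and v: "v \<in> tangent_space (toric_variety A) x"
    and u: "u \<in> int_kernel A"
  shows "(\<Sum>i\<in>UNIV. of_int (u $ i) * (v $ i / x $ i)) = 0"
proof (cases "u = 0")
  case False
  let ?f = "toric_binomial u :: ('k, 'n) polynomials"
  let ?s = "\<lambda>e :: nat^'n. \<Sum>i\<in>UNIV. of_nat (e $ i) * (v $ i / x $ i)"
  have ne: "pos_part u \<noteq> neg_part u"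
    using False pos_neg_parts[of u] by (metis cancel_comm_monoid_add_class.diff_cancel vec_eq_iff zero_index)
  have keys: "Poly_Mapping.keys ?f \<subseteq> {pos_part u, neg_part u}"
    by (auto simp: toric_binomial_def in_keys_iff lookup_minus lookup_single when_def split: if_splits)
  have "homogeneous_poly ?f"
    unfolding homogeneous_poly_def using keys equiv_exp_degree[OF equiv_exp_parts[OF u]]
    by (intro exI[of _ "\<Sum>i\<in>UNIV. pos_part u $ i"]) auto
  moreover have "eval_poly ?f y = 0" if "y \<in> toric_variety A" for y
    using that u by (auto simp: eval_toric_binomial toric_variety_iff)
  ultimately have "?f \<in> hom_vanishing (toric_variety A)" by (simp add: hom_vanishing_def)
  then have "0 = (\<Sum>i\<in>UNIV. eval_poly (partial_deriv i ?f) x * v $ i)"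
    using v by (simp add: tangent_space_def)
  also have "\<dots> = monom_val (pos_part u) x * ?s (pos_part u) - monom_val (neg_part u) x * ?s (neg_part u)"
    using ne by (subst directional_deriv[OF x(2) _ keys]) (simp_all add: toric_binomial_def lookup_minus lookup_single)
  also have "monom_val (neg_part u) x = monom_val (pos_part u) x"
    using x(1) u by (simp add: toric_variety_iff)
  finally have "?s (pos_part u) - ?s (neg_part u) = 0"
    using monom_val_nonzero[OF x(2), of "pos_part u"] by (simp flip: right_diff_distrib)
  moreover have "(of_int (u $ i) :: 'k) = of_nat (pos_part u $ i) - of_nat (neg_part u $ i)" for i
    unfolding pos_neg_parts[of u i, symmetric] by simp
  ultimately show ?thesis by (simp only: left_diff_distrib sum_subtractf)
qed simp

text \<open>In the coordinates \<open>v / x\<close> the tangent space is the row space of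
  \<open>A\<close>. Binomials give one inclusion; for the other, the derivative weights the
  coefficients of a vanishing form by a function constant on classes.\<close>

lemma tangent_space_eq:
  fixes x :: "'k::field_char_0^'n"
  assumes x: "x \<in> toric_variety A" "\<And>i. x $ i \<noteq> 0"
  shows "tangent_space (toric_variety A) x =
    {v. \<forall>i. of_int N * (v $ i / x $ i) = (\<Sum>j\<in>J. of_int (w j i) * (v $ j / x $ j))}" (is "_ = ?R")
proof (intro equalityI subsetI)
  fix v assume v: "v \<in> tangent_space (toric_variety A) x"
  have "of_int N * (v $ i / x $ i) = (\<Sum>j\<in>J. of_int (w j i) * (v $ j / x $ j))" for i
  proof -
    \<comment> \<open>The relation expressing \<open>N\<close> times column \<open>i\<close> through
      the columns in \<open>J\<close>, written as a kernel vector.\<close>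
    define u :: "int^'n" where "u = (\<chi> k. (if k = i then N else 0) - (if k \<in> J then w k i else 0))"
    have "(\<Sum>k\<in>UNIV. w j k * u $ k) = 0" if j: "j \<in> J" for j
    proof -
      have "(\<Sum>k\<in>UNIV. w j k * u $ k) = w j i * N - (\<Sum>k\<in>J. w j k * w k i)"
        by (simp add: u_def right_diff_distrib sum_subtractf if_distrib[of "\<lambda>c. _ * c"] sum.delta
            sum.If_cases cong: if_cong)
      also have "(\<Sum>k\<in>J. w j k * w k i) = (\<Sum>k\<in>J. if k = j then N * w k i else 0)"
        by (rule sum.cong) (use w_diag j in auto)
      finally show ?thesis using j by simp
    qed
    then have "u \<in> int_kernel A" by (simp add: kernel_iff)
    note zero = tangent_space_kernel[OF x v this]
    have "(\<Sum>k\<in>UNIV. of_int (u $ k) * (v $ k / x $ k)) =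
        (\<Sum>k\<in>UNIV. (if k = i then of_int N * (v $ k / x $ k) else 0) -
          (if k \<in> J then of_int (w k i) * (v $ k / x $ k) else 0))"
      by (rule sum.cong) (auto simp: u_def left_diff_distrib diff_divide_distrib)
    also have "\<dots> = of_int N * (v $ i / x $ i) - (\<Sum>k\<in>J. of_int (w k i) * (v $ k / x $ k))"
      unfolding sum_subtractf by (simp add: sum.delta sum.If_cases)
    finally show ?thesis using zero by simp
  qed
  then show "v \<in> ?R" by simp
next
  fix v assume v: "v \<in> ?R"
  define \<rho> where "\<rho> = (\<lambda>i. v $ i / x $ i)"
  have rho: "of_int N * \<rho> i = (\<Sum>j\<in>J. of_int (w j i) * \<rho> j)" for i using v by (simp add: \<rho>_def)
  have "(\<Sum>i\<in>UNIV. eval_poly (partial_deriv i f) x * v $ i) = 0" if f: "f \<in> hom_vanishing (toric_variety A)" for f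
  proof -
    obtain D where keys: "Poly_Mapping.keys f \<subseteq> exps D"
      using f unfolding hom_vanishing_def homogeneous_poly_def exps_def by auto
    \<comment> \<open>\<open>N\<close> times the weight of the coefficient at \<open>e\<close> in
      the directional derivative; it depends on \<open>e\<close> only through its class.\<close>
    define \<phi> where "\<phi> = (\<lambda>e. monom_val e x * (\<Sum>j\<in>J. of_int (weight j e) * \<rho> j))"
    define S where "S = (\<lambda>e :: nat^'n. \<Sum>i\<in>UNIV. of_nat (e $ i) * \<rho> i)"
    have S: "of_int N * S e = (\<Sum>j\<in>J. of_int (weight j e) * \<rho> j)" for e :: "nat^'n"
    proof -
      have "of_int N * S e = (\<Sum>i\<in>UNIV. of_nat (e $ i) * (of_int N * \<rho> i))"
        by (simp add: S_def sum_distrib_left algebra_simps)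
      also have "\<dots> = (\<Sum>j\<in>J. of_int (weight j e) * \<rho> j)"
        unfolding rho weight_def of_int_sum sum_distrib_left sum_distrib_right
        by (subst sum.swap) (simp add: algebra_simps)
      finally show ?thesis .
    qed
    have "(\<Sum>i\<in>UNIV. eval_poly (partial_deriv i f) x * v $ i) =
        (\<Sum>e\<in>exps D. Poly_Mapping.lookup f e * (monom_val e x * S e))"
      unfolding directional_deriv[OF x(2) finite_exps keys] S_def \<rho>_def ..
    then have "of_int N * (\<Sum>i\<in>UNIV. eval_poly (partial_deriv i f) x * v $ i) =
        (\<Sum>e\<in>exps D. Poly_Mapping.lookup f e * \<phi> e)"
      by (simp only: sum_distrib_left \<phi>_def S[symmetric] mult.left_commute[of "of_int N"])
    also have "\<dots> = 0"
    proof (rule vanishing_class_sum)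
      show "(\<Sum>e\<in>exps D. Poly_Mapping.lookup f e * monom_val e y) = 0" if "y \<in> toric_variety A" for y
        using f that by (simp add: hom_vanishing_def flip: eval_poly_superset[OF finite_exps keys])
      show "\<phi> e = \<phi> e'" if "equiv_exp e e'" for e e'
        using that x(1) unfolding \<phi>_def toric_variety_iff_equiv by (simp add: equiv_exp_def)
    qed
    finally show ?thesis using N_pos by simp
  qed
  then show "v \<in> tangent_space (toric_variety A) x" by (simp add: tangent_space_def)
qed

lemma dim_tangent_space:
  fixes x :: "'k::field_char_0^'n"
  assumes x: "x \<in> toric_variety A" "\<And>i. x $ i \<noteq> 0"
  shows "vec.dim (tangent_space (toric_variety A) x) = card J"
proof -
  \<comment> \<open>The rows of \<open>w\<close> scaled by \<open>x\<close>; on the coordinates in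
    \<open>J\<close> they form a diagonal matrix with nonzero diagonal.\<close>
  define b :: "'n \<Rightarrow> 'k^'n" where "b = (\<lambda>j. \<chi> i. of_int (w j i) * x $ i)"
  have N0: "of_int N \<noteq> (0 :: 'k)" using N_pos by simp
  have bJ: "b j $ i = (if i = j then of_int N * x $ j else 0)" if "i \<in> J" "j \<in> J" for i j
    using w_diag[OF that] by (simp add: b_def)
  have inj: "inj_on b J"
  proof
    fix i j assume ij: "i \<in> J" "j \<in> J" "b i = b j"
    have "b j $ i \<noteq> 0" using bJ[OF ij(1,1)] N0 x(2)[of i] unfolding ij(3)[symmetric] by simp
    then show "i = j" unfolding bJ[OF ij(1,2)] by presburger
  qed
  show ?thesis
  proof (rule vec.dim_unique)
    show "b ` J \<subseteq> tangent_space (toric_variety A) x"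
    proof
      fix v assume "v \<in> b ` J"
      then obtain j where j: "j \<in> J" "v = b j" by blast
      have "(\<Sum>k\<in>J. of_int (w k i) * (v $ k / x $ k)) = of_int N * (v $ i / x $ i)" for i
      proof -
        have "(\<Sum>k\<in>J. of_int (w k i) * (v $ k / x $ k)) = (\<Sum>k\<in>J. if k = j then of_int (w k i) * of_int N else 0)"
          by (rule sum.cong) (use j bJ x(2) in auto)
        then show ?thesis using j x(2) by (simp add: b_def)
      qed
      then show "v \<in> tangent_space (toric_variety A) x" unfolding tangent_space_eq[OF x] by simp
    qed
    show "tangent_space (toric_variety A) x \<subseteq> vec.span (b ` J)"
    proof
      fix v assume "v \<in> tangent_space (toric_variety A) x"
      then have v: "of_int N * (v $ i / x $ i) = (\<Sum>j\<in>J. of_int (w j i) * (v $ j / x $ j))" for i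
        unfolding tangent_space_eq[OF x] by blast
      have "v = (\<Sum>j\<in>J. (v $ j / (of_int N * x $ j)) *s b j)"
      proof (subst vec_eq_iff, rule allI)
        fix i
        have "v $ i = (\<Sum>j\<in>J. of_int (w j i) * (v $ j / x $ j)) * x $ i / of_int N"
          using v[of i] N0 x(2)[of i] by (simp add: field_simps)
        also have "\<dots> = (\<Sum>j\<in>J. of_int (w j i) * (v $ j / x $ j) * x $ i / of_int N)"
          by (simp only: sum_distrib_right sum_divide_distrib)
        also have "\<dots> = (\<Sum>j\<in>J. (v $ j / (of_int N * x $ j)) *s b j) $ i"
          by (simp add: b_def mult_ac)
        finally show "v $ i = (\<Sum>j\<in>J. (v $ j / (of_int N * x $ j)) *s b j) $ i" .
      qed
      also have "\<dots> \<in> vec.span (b ` J)"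
        by (intro vec.span_sum vec.span_scale vec.span_base) auto
      finally show "v \<in> vec.span (b ` J)" .
    qed
    show "vec.independent (b ` J)"
    proof
      assume "vec.dependent (b ` J)"
      then obtain c j where c: "j \<in> J" "c (b j) \<noteq> 0" "(\<Sum>v\<in>b ` J. c v *s v) = 0"
        by (subst (asm) vec.dependent_finite) auto
      have "0 = (\<Sum>k\<in>J. c (b k) *s b k) $ j" using c(3) by (simp add: sum.reindex[OF inj])
      also have "\<dots> = (\<Sum>k\<in>J. if k = j then c (b k) * (of_int N * x $ k) else 0)"
        unfolding sum_component by (rule sum.cong) (use bJ c(1) in auto)
      also have "\<dots> = c (b j) * (of_int N * x $ j)" using c(1) by simp
      finally show False using c(2) N0 x(2)[of j] by simp
    qed
    show "card (b ` J) = card J" by (rule card_image[OF inj])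
  qed
qed

end


section \<open>The dimension of the toric variety\<close>

text \<open>Independence of the restrictions to \<open>Z\<close>: for forms of degree
  \<open>D\<close> this bounds the Hilbert function of \<open>Z\<close> at \<open>D\<close> from
  below by \<open>n\<close>.\<close>

definition indep_on :: "('k::field^'n) set \<Rightarrow> nat \<Rightarrow> (nat \<Rightarrow> 'k^'n \<Rightarrow> 'k) \<Rightarrow> bool" where
  "indep_on Z n F \<longleftrightarrow> (\<forall>c. (\<forall>x\<in>Z. (\<Sum>k<n. c k * F k x) = 0) \<longrightarrow> (\<forall>k<n. c k = 0))"

lemma sum_lessThan_add: "(\<Sum>k<a + b. f k) = (\<Sum>k<a. f k) + (\<Sum>k<b. f (a + k :: nat) :: 'a::comm_monoid_add)"
  by (induction b) (simp_all add: add.assoc)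

text \<open>On \<open>Z\<close> the multiples of \<open>g\<close> vanish, which kills the
  coefficients of \<open>F\<close>; the remaining relation is a multiple of \<open>g\<close> on
  \<open>Z'\<close>, where irreducibility allows cancelling \<open>g\<close>.\<close>

lemma indep_on_extend:
  fixes Z Z' :: "('k::field^'n) set"
  assumes irr: "irreducible_closed Z'" and ZZ': "Z \<subseteq> Z'"
    and g: "form E g" "\<And>x. x \<in> Z \<Longrightarrow> g x = 0" "y \<in> Z'" "g y \<noteq> 0"
    and F: "indep_on Z a F" and G: "\<And>k. form D (G k)" "indep_on Z' b G"
  shows "indep_on Z' (a + b) (\<lambda>k. if k < a then F k else (\<lambda>x. g x * G (k - a) x))"
  unfolding indep_on_def
proof (intro allI impI)
  fix c k
  assume rel: "\<forall>x\<in>Z'. (\<Sum>k<a + b. c k * (if k < a then F k else (\<lambda>x. g x * G (k - a) x)) x) = 0" and k: "k < a + b"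
  define S where "S = (\<lambda>x. \<Sum>k<b. c (a + k) * G k x)"
  have split: "(\<Sum>k<a. c k * F k x) + g x * S x = 0" if "x \<in> Z'" for x
  proof -
    have "(\<Sum>k<a. c k * F k x) + g x * S x =
        (\<Sum>k<a + b. c k * (if k < a then F k else (\<lambda>x. g x * G (k - a) x)) x)"
      unfolding sum_lessThan_add S_def by (simp add: sum_distrib_left mult.left_commute)
    then show ?thesis using rel that by simp
  qed
  have low: "c k = 0" if "k < a" for k
  proof -
    have "\<forall>x\<in>Z. (\<Sum>k<a. c k * F k x) = 0"
      using split g(2) ZZ' by fastforce
    with F that show ?thesis unfolding indep_on_def by blast
  qed
  have "g x * S x = 0" if "x \<in> Z'" for x using split[OF that] low by simp
  moreover have "form D S" unfolding S_def by (intro form_sum form_scale G)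
  ultimately have "\<forall>x\<in>Z'. S x = 0"
    using irreducible_closed_form[OF irr g(1)] g(3,4) by blast
  then have high: "c (a + k) = 0" if "k < b" for k
    using G(2)[unfolded indep_on_def, rule_format, of "\<lambda>k. c (a + k)"] that unfolding S_def by blast
  show "c k = 0" using low[of k] high[of "k - a"] k by (cases "k < a") auto
qed

lemma irreducible_closed_nonzero_coord:
  assumes "irreducible_closed Z"
  obtains x i where "x \<in> Z" "x $ i \<noteq> 0"
proof -
  obtain x where x: "x \<in> Z" using assms unfolding irreducible_closed_def by blast
  then have "x \<noteq> 0" using assms zariski_closed_nonzero unfolding irreducible_closed_def by blast
  then obtain i where "x $ i \<noteq> 0" by (auto simp: vec_eq_iff)
  with x that show ?thesis by blast
qed

lemma form_coord_power: "form d (\<lambda>x. x $ i ^ d)"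
  using form_power[OF form_coord, of d i] by simp

lemma indep_on_one:
  fixes Z :: "('k::field^'n) set"
  assumes "irreducible_closed Z"
  shows "\<exists>F. (\<forall>l. form d (F l)) \<and> indep_on Z 1 F"
proof -
  obtain x i where x: "x \<in> Z" "x $ i \<noteq> 0" using assms by (rule irreducible_closed_nonzero_coord)
  then have "indep_on Z 1 (\<lambda>_ x. x $ i ^ d)" unfolding indep_on_def by auto
  then show ?thesis using form_coord_power by (intro exI[of _ "\<lambda>_ x. x $ i ^ d"]) blast
qed

text \<open>
  Along a chain of irreducible closed sets, multiplication by forms cutting out the smaller sets
  gives at least as many independent forms as there are monomials in \<open>i + 1\<close> variables.
\<close>

lemma chain_indep_forms:
  fixes Z :: "nat \<Rightarrow> ('k::field^'n) set"
  assumes irr: "\<And>i. i \<le> k \<Longrightarrow> irreducible_closed (Z i)" and chain: "\<And>i. i < k \<Longrightarrow> Z i \<subset> Z (Suc i)"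
  shows "\<exists>E. \<forall>i\<le>k. \<forall>d. \<exists>F. (\<forall>l. form (d * E) (F l)) \<and> indep_on (Z i) ((d + i) choose i) F"
proof -
  have "\<exists>e g x. form e g \<and> (\<forall>z\<in>Z i. g z = 0) \<and> x \<in> Z (Suc i) \<and> g x \<noteq> 0" if i: "i < k" for i
  proof -
    obtain x where x: "x \<in> Z (Suc i)" "x \<notin> Z i" using chain[OF i] by blast
    have "zariski_closed (Z i)" "zariski_closed (Z (Suc i))"
      using irr[of i] irr[of "Suc i"] i by (simp_all add: irreducible_closed_def)
    then obtain e g where "form e g" "\<And>z. z \<in> Z i \<Longrightarrow> g z = 0" "g x \<noteq> 0"
      using zariski_closed_obtain_form zariski_closed_nonzero x by metis
    with x show ?thesis by blast
  qed
  then obtain e g x where g: "\<And>i. i < k \<Longrightarrow> form (e i) (g i)" "\<And>i z. i < k \<Longrightarrow> z \<in> Z i \<Longrightarrow> g i z = 0"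
      "\<And>i. i < k \<Longrightarrow> x i \<in> Z (Suc i)" "\<And>i. i < k \<Longrightarrow> g i (x i) \<noteq> 0"
    by metis
  \<comment> \<open>A common degree: each \<open>g i\<close> is padded to degree \<open>E\<close>
    with a power of a coordinate that is nonzero at \<open>x i\<close>.\<close>
  define E where "E = (\<Sum>i<k. e i)"
  have g': "\<exists>h y. form E h \<and> (\<forall>z\<in>Z i. h z = 0) \<and> y \<in> Z (Suc i) \<and> h y \<noteq> 0" if i: "i < k" for i
  proof -
    have "zariski_closed (Z (Suc i))" using irr[of "Suc i"] i by (simp add: irreducible_closed_def)
    then have "x i \<noteq> 0" using zariski_closed_nonzero g(3)[OF i] by blast
    then obtain m where m: "x i $ m \<noteq> 0" by (auto simp: vec_eq_iff)
    have "e i \<le> E" unfolding E_def using i by (intro member_le_sum) auto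
    then have "form E (\<lambda>z. g i z * z $ m ^ (E - e i))"
      using form_mult[OF g(1)[OF i] form_coord_power[of "E - e i" m]] by simp
    then show ?thesis using g[OF i] m by (intro exI[of _ "\<lambda>z. g i z * z $ m ^ (E - e i)"] exI[of _ "x i"]) auto
  qed
  have "\<exists>F. (\<forall>l. form (d * E) (F l)) \<and> indep_on (Z i) ((d + i) choose i) F" if "i \<le> k" for i d
    using that
  proof (induction i arbitrary: d)
    case 0
    then show ?case using indep_on_one[OF irr[of 0]] by simp
  next
    case (Suc i)
    then have i: "i < k" "i \<le> k" by simp_all
    note outer = Suc.IH[OF i(2)]
    obtain h y where h: "form E h" "\<And>z. z \<in> Z i \<Longrightarrow> h z = 0" "y \<in> Z (Suc i)" "h y \<noteq> 0"
      using g'[OF i(1)] by blast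
    show ?case
    proof (induction d)
      case 0
      then show ?case using indep_on_one[OF irr[of "Suc i"]] Suc.prems by simp
    next
      case (Suc d)
      obtain F where F: "\<And>l. form (Suc d * E) (F l)" "indep_on (Z i) ((Suc d + i) choose i) F"
        using outer[of "Suc d"] by blast
      obtain G where G: "\<And>l. form (d * E) (G l)" "indep_on (Z (Suc i)) ((d + Suc i) choose Suc i) G"
        using Suc.IH by blast
      define a where "a = (Suc d + i) choose i"
      \<comment> \<open>Forms independent on \<open>Z i\<close>, together with \<open>h\<close>
        times lower-degree forms independent on \<open>Z (Suc i)\<close>; their numbers add up by
        Pascal's rule.\<close>
      define H where "H = (\<lambda>k. if k < a then F k else (\<lambda>x. h x * G (k - a) x))"
      have "indep_on (Z (Suc i)) (a + ((d + Suc i) choose Suc i)) H"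
        unfolding H_def a_def by (rule indep_on_extend[OF irr _ h F(2) G]) (use i chain in auto)
      moreover have "a + ((d + Suc i) choose Suc i) = ((Suc d + Suc i) choose Suc i)"
        by (simp add: a_def)
      ultimately have "indep_on (Z (Suc i)) ((Suc d + Suc i) choose Suc i) H" by (simp only:)
      moreover have "form (Suc d * E) (H l)" for l
        using F(1)[of l] form_mult[OF h(1) G(1)[of "l - a"]] by (simp add: H_def)
      ultimately show ?case by blast
    qed
  qed
  then show ?thesis by blast
qed

section \<open>Upper bound for the length of chains\<close>

context column_basis
begin

definition weight_bound :: nat where
  "weight_bound = nat (\<Sum>j\<in>J. \<Sum>i\<in>UNIV. \<bar>w j i\<bar>)"

lemma abs_w_le: "j \<in> J \<Longrightarrow> \<bar>w j i\<bar> \<le> int weight_bound"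
proof -
  assume j: "j \<in> J"
  have "\<bar>w j i\<bar> \<le> (\<Sum>i\<in>UNIV. \<bar>w j i\<bar>)" by (rule member_le_sum) auto
  also have "\<dots> \<le> (\<Sum>j\<in>J. \<Sum>i\<in>UNIV. \<bar>w j i\<bar>)"
    using j by (intro member_le_sum[of j J "\<lambda>j. \<Sum>i\<in>UNIV. \<bar>w j i\<bar>"]) (auto intro: sum_nonneg)
  finally show ?thesis unfolding weight_bound_def by linarith
qed

lemma abs_weight_le: "j \<in> J \<Longrightarrow> e \<in> exps D \<Longrightarrow> \<bar>weight j e\<bar> \<le> int (weight_bound * D)"
proof -
  assume j: "j \<in> J" and e: "e \<in> exps D"
  have "\<bar>weight j e\<bar> \<le> (\<Sum>i\<in>UNIV. \<bar>w j i * int (e $ i)\<bar>)" unfolding weight_def by (rule sum_abs)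
  also have "\<dots> \<le> (\<Sum>i\<in>UNIV. int weight_bound * int (e $ i))"
    by (rule sum_mono) (use abs_w_le[OF j] in \<open>auto simp: abs_mult intro: mult_right_mono\<close>)
  also have "\<dots> = int (weight_bound * (\<Sum>i\<in>UNIV. e $ i))" by (simp add: sum_distrib_left)
  finally show ?thesis using e by (simp only: exps_def mem_Collect_eq)
qed

lemma J_nonempty: "J \<noteq> {}"
  using w_sum N_pos by force

text \<open>
  The restriction of a form of degree \<open>D\<close> is determined by its class sums, and the
  weights of a class of exponents of degree \<open>D\<close> add up to \<open>N * D\<close>.
\<close>

lemma indep_on_toric_variety_le:
  assumes F: "\<And>k. form D (F k)" and ind: "indep_on (toric_variety A :: ('k::field^'n) set) n F"
  shows "n \<le> (2 * weight_bound * D + 1) ^ (card J - 1)"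
proof (rule ccontr)
  assume neg: "\<not> ?thesis"
  obtain j0 where j0: "j0 \<in> J" using J_nonempty by blast
  \<comment> \<open>The weight at \<open>j0\<close> is determined by the other weights and the
    degree; dropping it lowers the exponent of the bound to \<open>card J - 1\<close>.\<close>
  define I where "I = J - {j0}"
  define key where "key = (\<lambda>e. restrict (\<lambda>j. weight j e) I)"
  define B where "B = key ` (exps D)"
  have "B \<subseteq> PiE I (\<lambda>_. {- int (weight_bound * D)..int (weight_bound * D)})"
  proof
    fix b assume "b \<in> B"
    then obtain e where e: "e \<in> exps D" "b = key e" by (auto simp: B_def)
    have "weight j e \<in> {- int (weight_bound * D)..int (weight_bound * D)}" if "j \<in> I" for j
      using abs_weight_le[OF _ e(1), of j] that by (auto simp: I_def abs_le_iff)
    then show "b \<in> PiE I (\<lambda>_. {- int (weight_bound * D)..int (weight_bound * D)})"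
      unfolding e(2) key_def by auto
  qed
  then have "card B \<le> card (PiE I (\<lambda>_. {- int (weight_bound * D)..int (weight_bound * D)}))"
    by (intro card_mono finite_PiE) auto
  also have "\<dots> = (2 * weight_bound * D + 1) ^ card I"
    by (simp add: card_PiE nat_add_distrib nat_mult_distrib algebra_simps)
  also have "card I = card J - 1" using j0 by (simp add: I_def)
  finally have cardB: "card B < card {..<n}" using neg by simp
  have key: "equiv_exp e e'" if e: "e \<in> exps D" "e' \<in> exps D" "key e = key e'" for e e'
  proof -
    have eqI: "weight j e = weight j e'" if "j \<in> I" for j
      using fun_cong[OF e(3), of j] that by (simp add: key_def)
    have "weight j0 e + (\<Sum>j\<in>I. weight j e) = weight j0 e' + (\<Sum>j\<in>I. weight j e')"
      using weight_sum[of e] weight_sum[of e'] e(1,2) sum.remove[OF _ j0, of "\<lambda>j. weight j e"]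
        sum.remove[OF _ j0, of "\<lambda>j. weight j e'"] by (simp add: I_def exps_def del: of_nat_sum)
    then have "weight j0 e = weight j0 e'" using eqI by simp
    with eqI show ?thesis unfolding equiv_exp_def I_def by blast
  qed
  have "\<forall>k. \<exists>a. \<forall>x. F k x = (\<Sum>e\<in>exps D. a e * monom_val e x)" using F unfolding form_def by blast
  then obtain a where a: "\<And>k x. F k x = (\<Sum>e\<in>exps D. a k e * monom_val e x)" by metis
  \<comment> \<open>With more forms than keys, some nontrivial combination has all class sums zero
    and hence vanishes on the variety.\<close>
  obtain c where c: "\<exists>k<n. c k \<noteq> 0"
    "\<And>b. b \<in> B \<Longrightarrow> (\<Sum>k<n. c k * (\<Sum>e\<in>{e \<in> exps D. key e = b}. a k e)) = 0"
    using linear_dependence[OF _ _ cardB, of "\<lambda>k b. \<Sum>e\<in>{e \<in> exps D. key e = b}. a k e"]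
    by (auto simp: B_def)
  have "(\<Sum>k<n. c k * F k x) = 0" if x: "x \<in> toric_variety A" for x
  proof -
    have "(\<Sum>k<n. c k * F k x) = (\<Sum>e\<in>exps D. (\<Sum>k<n. c k * a k e) * monom_val e x)"
      unfolding a sum_distrib_left sum_distrib_right by (subst sum.swap) (simp add: mult.assoc)
    also have "\<dots> = (\<Sum>b\<in>B. \<Sum>e\<in>{e \<in> exps D. key e = b}. (\<Sum>k<n. c k * a k e) * monom_val e x)"
      by (rule sum.group[symmetric]) (auto simp: B_def)
    also have "\<dots> = 0"
    proof (rule sum.neutral, rule ballI)
      fix b assume b: "b \<in> B"
      then obtain e0 where e0: "e0 \<in> exps D" "key e0 = b" by (auto simp: B_def)
      have "(\<Sum>e\<in>{e \<in> exps D. key e = b}. (\<Sum>k<n. c k * a k e) * monom_val e x) =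
          (\<Sum>e\<in>{e \<in> exps D. key e = b}. (\<Sum>k<n. c k * a k e) * monom_val e0 x)"
      proof (rule sum.cong[OF refl])
        fix e assume "e \<in> {e \<in> exps D. key e = b}"
        with e0 have "equiv_exp e e0" by (intro key) auto
        then have "monom_val e x = monom_val e0 x" using x unfolding toric_variety_iff_equiv by blast
        then show "(\<Sum>k<n. c k * a k e) * monom_val e x = (\<Sum>k<n. c k * a k e) * monom_val e0 x" by simp
      qed
      also have "\<dots> = (\<Sum>e\<in>{e \<in> exps D. key e = b}. \<Sum>k<n. c k * a k e) * monom_val e0 x"
        by (rule sum_distrib_right[symmetric])
      also have "(\<Sum>e\<in>{e \<in> exps D. key e = b}. \<Sum>k<n. c k * a k e) = 0"
        using c(2)[OF b] by (subst sum.swap) (simp add: sum_distrib_left)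
      finally show "(\<Sum>e\<in>{e \<in> exps D. key e = b}. (\<Sum>k<n. c k * a k e) * monom_val e x) = 0" by simp
    qed
    finally show ?thesis .
  qed
  with ind c(1) show False unfolding indep_on_def by blast
qed

text \<open>Growth rates collide: a chain of length \<open>r = card J\<close> forces at least
  \<open>(d + r) choose r\<close> independent forms of degree \<open>d * E\<close>, of order
  \<open>d ^ r\<close>, while the variety carries only order \<open>d ^ (r - 1)\<close>.\<close>

lemma chain_length_less:
  fixes Z :: "nat \<Rightarrow> ('k::field^'n) set"
  assumes irr: "\<And>i. i \<le> k \<Longrightarrow> irreducible_closed (Z i)" and chain: "\<And>i. i < k \<Longrightarrow> Z i \<subset> Z (Suc i)"
    and X: "\<And>i. i \<le> k \<Longrightarrow> Z i \<subseteq> toric_variety A"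
  shows "k < card J"
proof (rule ccontr)
  assume "\<not> k < card J"
  define r where "r = card J"
  have r: "r \<le> k" "r > 0" using \<open>\<not> k < card J\<close> J_nonempty by (simp_all add: r_def card_gt_0_iff)
  obtain E where E: "\<And>i d. i \<le> k \<Longrightarrow> \<exists>F. (\<forall>l. form (d * E) (F l)) \<and> indep_on (Z i) ((d + i) choose i) F"
    using chain_indep_forms[of k Z] irr chain by metis
  define C where "C = 2 * weight_bound * E + 1"
  \<comment> \<open>Just beyond the bound \<open>r ^ r * C ^ (r - 1)\<close> on \<open>d\<close>
    that follows from \<open>(d / r) ^ r \<le> (C * d) ^ (r - 1)\<close>.\<close>
  define d where "d = r ^ r * C ^ (r - 1) + 1"
  obtain F where F: "\<And>l. form (d * E) (F l)" "indep_on (Z r) ((d + r) choose r) F"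
    using E[OF r(1), of d] by blast
  have "indep_on (toric_variety A) ((d + r) choose r) F"
    using F(2) X[OF r(1)] unfolding indep_on_def by blast
  from indep_on_toric_variety_le[OF F(1) this]
  have le: "(d + r) choose r \<le> (2 * weight_bound * (d * E) + 1) ^ (r - 1)" by (simp add: r_def)
  have "2 * weight_bound * (d * E) + 1 \<le> C * d" by (simp add: C_def d_def algebra_simps)
  then have "(2 * weight_bound * (d * E) + 1) ^ (r - 1) \<le> (C * d) ^ (r - 1)" by (rule power_mono) simp
  with le have le': "real ((d + r) choose r) \<le> real ((C * d) ^ (r - 1))" by linarith
  have "(real d / real r) ^ r \<le> (real (d + r) / real r) ^ r"
    by (intro power_mono divide_right_mono) auto
  also have "\<dots> \<le> real ((d + r) choose r)"
    using binomial_ge_n_over_k_pow_k[of r "d + r", where 'a = real] by simp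
  also note le'
  finally have "real d ^ r \<le> real r ^ r * (real C * real d) ^ (r - 1)"
    using r by (simp add: power_divide divide_le_eq mult.commute)
  then have "real (d ^ r) \<le> real (r ^ r * C ^ (r - 1) * d ^ (r - 1))"
    by (simp add: power_mult_distrib mult.assoc)
  then have "d ^ r \<le> r ^ r * C ^ (r - 1) * d ^ (r - 1)" by (simp only: of_nat_le_iff)
  moreover have "d ^ r = d * d ^ (r - 1)" using r(2) by (simp add: power_eq_if)
  moreover have "d ^ (r - 1) > 0" by (simp add: d_def)
  ultimately have "d \<le> r ^ r * C ^ (r - 1)" using mult_le_cancel2[of d "d ^ (r - 1)"] by metis
  then show False by (simp add: d_def)
qed

section \<open>Subtori and a chain of maximal length\<close>

definition subtorus_vector :: "'n set \<Rightarrow> 'k \<Rightarrow> ('n \<Rightarrow> 'k) \<Rightarrow> 'k::field^'n" where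
  "subtorus_vector B s t = (\<chi> i. s * (\<Prod>j\<in>B. t j ^ nat (w j i + int weight_bound)))"

text \<open>For \<open>B\<close> inside \<open>J\<close>, the orbit of the all-ones vector under
  scalars and the one-parameter subgroups with exponents \<open>w j\<close>; the shift by
  \<open>weight_bound\<close> makes exponents natural and changes vectors only by a scalar.\<close>

definition subtorus :: "'n set \<Rightarrow> ('k::field^'n) set" where
  "subtorus B = {subtorus_vector B s t |s t. s \<noteq> 0 \<and> (\<forall>j\<in>B. t j \<noteq> 0)}"

lemma subtorus_nonzero: "x \<in> subtorus B \<Longrightarrow> x $ i \<noteq> 0"
  by (auto simp: subtorus_def subtorus_vector_def)

lemma zero_notin_subtorus: "0 \<notin> subtorus B"
  using subtorus_nonzero by fastforce

text \<open>At such a point a monomial depends on its exponent only through the degree and the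
  weights for \<open>j\<close> in \<open>B\<close>, which are class invariants.\<close>

lemma subtorus_subset:
  assumes "B \<subseteq> J" shows "subtorus B \<subseteq> toric_variety A"
proof
  fix x :: "'k::field^'n" assume x: "x \<in> subtorus B"
  then obtain s t where st: "x = subtorus_vector B s t" by (auto simp: subtorus_def)
  define m where "m = (\<lambda>j e. \<Sum>i\<in>UNIV. nat (w j i + int weight_bound) * e $ i)"
  have mon: "monom_val e x = s ^ (\<Sum>i\<in>UNIV. e $ i) * (\<Prod>j\<in>B. t j ^ m j e)" for e
  proof -
    have "(\<Prod>i\<in>UNIV. \<Prod>j\<in>B. (t j ^ nat (w j i + int weight_bound)) ^ e $ i) = (\<Prod>j\<in>B. t j ^ m j e)"
      by (subst prod.swap) (simp add: m_def power_sum flip: power_mult)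
    then show ?thesis
      by (simp add: st monom_val_def subtorus_vector_def power_mult_distrib prod.distrib power_sum prod_power_distrib)
  qed
  have m: "int (m j e) = weight j e + int weight_bound * int (\<Sum>i\<in>UNIV. e $ i)" if j: "j \<in> B" for j e
  proof -
    have "w j i + int weight_bound \<ge> 0" for i using abs_w_le[of j i] j assms by (auto simp: abs_le_iff)
    then show ?thesis by (simp add: m_def weight_def algebra_simps sum.distrib sum_distrib_left)
  qed
  have "monom_val e x = monom_val e' x" if e: "equiv_exp e e'" for e e'
  proof -
    have "m j e = m j e'" if "j \<in> B" for j
    proof -
      have "int (m j e) = int (m j e')"
        unfolding m[OF that] equiv_exp_degree[OF e] using e that assms by (auto simp: equiv_exp_def)
      then show ?thesis by simp
    qed
    then show ?thesis unfolding mon equiv_exp_degree[OF e] by simp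
  qed
  moreover have "x \<noteq> 0" using subtorus_nonzero[OF x] by (metis zero_index)
  ultimately show "x \<in> toric_variety A" unfolding toric_variety_iff_equiv by blast
qed

text \<open>Two points of a subtorus lie on a rational curve contained, up to finitely many points, in it.\<close>

lemma irreducible_closed_subtorus:
  "irreducible_closed (zariski_closed hull (subtorus B :: ('k::field_char_0^'n) set))"
proof (rule irreducible_closed_hull)
  show "0 \<notin> (subtorus B :: ('k^'n) set)" by (rule zero_notin_subtorus)
  have "subtorus_vector B 1 (\<lambda>_. 1) \<in> (subtorus B :: ('k^'n) set)"
    unfolding subtorus_def by (intro CollectI exI conjI) auto
  then show "subtorus B \<noteq> ({} :: ('k^'n) set)" by blast
next
  fix a b f g and x y :: "'k^'n"
  assume f: "form a f" and g: "form b g" and x: "x \<in> subtorus B" and fx: "f x \<noteq> 0"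
    and y: "y \<in> subtorus B" and gy: "g y \<noteq> 0"
  obtain s t where st: "x = subtorus_vector B s t" "s \<noteq> 0" "\<forall>j\<in>B. t j \<noteq> 0"
    using x by (auto simp: subtorus_def)
  obtain s' t' where st': "y = subtorus_vector B s' t'" "s' \<noteq> 0" "\<forall>j\<in>B. t' j \<noteq> 0"
    using y by (auto simp: subtorus_def)
  \<comment> \<open>Straight lines in the parameters, from those of \<open>x\<close> at 0 to those
    of \<open>y\<close> at 1.\<close>
  define ps where "ps = [:s, s' - s:]"
  define pt where "pt = (\<lambda>j. [:t j, t' j - t j:])"
  define q where "q = (\<lambda>i. ps * (\<Prod>j\<in>B. pt j ^ nat (w j i + int weight_bound)))"
  have curve: "(\<chi> i. poly (q i) z) = subtorus_vector B (poly ps z) (\<lambda>j. poly (pt j) z)" for z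
    by (simp add: subtorus_vector_def q_def poly_prod)
  have at0: "(\<chi> i. poly (q i) 0) = x" unfolding curve st(1) by (simp add: ps_def pt_def)
  have at1: "(\<chi> i. poly (q i) 1) = y" unfolding curve st'(1) by (simp add: ps_def pt_def)
  have pull: "\<exists>F. \<forall>z. poly F z = h (\<chi> i. poly (q i) z)" if h: "form D h" for D h
  proof -
    obtain c where c: "\<And>x. h x = (\<Sum>e\<in>exps D. c e * monom_val e x)" using h unfolding form_def by blast
    show ?thesis
      by (intro exI[of _ "\<Sum>e\<in>exps D. [:c e:] * (\<Prod>i\<in>UNIV. q i ^ e $ i)"])
        (simp add: c monom_val_def poly_sum poly_prod)
  qed
  obtain F where F: "\<And>z. poly F z = f (\<chi> i. poly (q i) z)" using pull[OF f] by blast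
  obtain G where G: "\<And>z. poly G z = g (\<chi> i. poly (q i) z)" using pull[OF g] by blast
  \<comment> \<open>Nonzero values of \<open>H\<close> mark the parameters where both forms are
    nonzero and the curve stays in the subtorus.\<close>
  define H where "H = F * G * ps * (\<Prod>j\<in>B. pt j)"
  have "F \<noteq> 0" using F[of 0] fx unfolding at0 by auto
  moreover have "G \<noteq> 0" using G[of 1] gy unfolding at1 by auto
  moreover have "ps \<noteq> 0" "\<And>j. j \<in> B \<Longrightarrow> pt j \<noteq> 0" using st by (auto simp: ps_def pt_def)
  ultimately have "H \<noteq> 0" by (simp add: H_def)
  then have "finite {z. poly H z = 0}" by (rule poly_roots_finite)
  then obtain z where "poly H z \<noteq> 0"
    using ex_new_if_finite[OF infinite_UNIV_char_0[where 'a = 'k]] by blast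
  then have z: "poly F z \<noteq> 0" "poly G z \<noteq> 0" "poly ps z \<noteq> 0" "\<And>j. j \<in> B \<Longrightarrow> poly (pt j) z \<noteq> 0"
    by (auto simp: H_def poly_prod)
  have "(\<chi> i. poly (q i) z) \<in> subtorus B"
    unfolding curve subtorus_def using z(3,4) by blast
  then show "\<exists>z\<in>subtorus B. f z \<noteq> 0 \<and> g z \<noteq> 0" using z(1,2) unfolding F G by blast
qed

text \<open>Coordinates \<open>j\<close> and \<open>j0\<close> agree on the subtorus of
  \<open>B\<close>, since both exponents reduce to the shift there. They differ at the point with
  parameter 2 in direction \<open>j\<close>, as 2 is no root of unity in characteristic
  zero.\<close>

lemma subtorus_hull_psubset:
  assumes B: "insert j B \<subseteq> J" "j \<notin> B" and j0: "j0 \<in> J" "j0 \<notin> B" "j0 \<noteq> j"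
  shows "zariski_closed hull subtorus B \<subset> zariski_closed hull (subtorus (insert j B) :: ('k::field_char_0^'n) set)"
proof
  have fin: "finite B" by simp
  have "subtorus B \<subseteq> (subtorus (insert j B) :: ('k^'n) set)"
  proof
    fix x :: "'k^'n" assume "x \<in> subtorus B"
    then obtain s t where st: "x = subtorus_vector B s t" "s \<noteq> 0" "\<forall>j\<in>B. t j \<noteq> 0"
      by (auto simp: subtorus_def)
    have "(\<Prod>k\<in>B. (t(j := 1)) k ^ nat (w k i + int weight_bound)) = (\<Prod>k\<in>B. t k ^ nat (w k i + int weight_bound))" for i
      by (rule prod.cong) (use B(2) in auto)
    then have "x = subtorus_vector (insert j B) s (t(j := 1))"
      unfolding st(1) subtorus_vector_def prod.insert[OF fin B(2)] by simp
    then show "x \<in> subtorus (insert j B)"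
      unfolding subtorus_def using st(2,3) by (intro CollectI exI[of _ s] exI[of _ "t(j := 1)"]) simp
  qed
  then show "zariski_closed hull subtorus B \<subseteq> zariski_closed hull (subtorus (insert j B) :: ('k^'n) set)"
    by (rule hull_mono)
  have wj: "w l j = w l j0" if "l \<in> B" for l
    using w_diag[of j l] w_diag[of j0 l] that B j0 by auto
  have "x $ j + (- 1) * x $ j0 = 0" if "x \<in> subtorus B" for x :: "'k^'n"
    using that wj by (auto simp: subtorus_def subtorus_vector_def)
  moreover have "form 1 (\<lambda>x :: 'k^'n. x $ j + (- 1) * x $ j0)" by (intro form_add form_scale form_coord)
  ultimately have van: "x $ j + (- 1) * x $ j0 = 0" if "x \<in> zariski_closed hull subtorus B" for x :: "'k^'n"
    using that unfolding zariski_hull_eq[OF zero_notin_subtorus] by blast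
  define y :: "'k^'n" where "y = subtorus_vector (insert j B) 1 (\<lambda>k. if k = j then 2 else 1)"
  have "y \<in> subtorus (insert j B)"
    unfolding y_def subtorus_def by (intro CollectI exI conjI refl) (auto split: if_splits)
  then have yin: "y \<in> zariski_closed hull subtorus (insert j B)" by (rule hull_inc)
  have y: "y $ i = 2 ^ nat (w j i + int weight_bound)" for i
  proof -
    have "(\<Prod>k\<in>B. (if k = j then 2 else 1 :: 'k) ^ nat (w k i + int weight_bound)) = 1"
      by (rule prod.neutral) (use B(2) in auto)
    then show ?thesis by (simp add: y_def subtorus_vector_def B(2))
  qed
  have "y $ j = 2 ^ (nat N + weight_bound)" "y $ j0 = 2 ^ weight_bound"
    using w_diag[of j j] w_diag[of j0 j] B j0 N_pos by (simp_all add: y nat_add_distrib)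
  moreover have "(2 :: 'k) ^ nat N \<noteq> 1"
  proof
    assume "(2 :: 'k) ^ nat N = 1"
    then have "of_nat (2 ^ nat N) = (of_nat 1 :: 'k)" by simp
    then have "(2 :: nat) ^ nat N = 1" by (simp only: of_nat_eq_iff)
    with N_pos show False by simp
  qed
  ultimately have "y $ j + (- 1) * y $ j0 \<noteq> 0" by (simp add: power_add)
  with van have "y \<notin> zariski_closed hull subtorus B" by blast
  with yin show "zariski_closed hull subtorus B \<noteq> zariski_closed hull (subtorus (insert j B) :: ('k^'n) set)" by blast
qed

text \<open>Adjoining the elements of \<open>J\<close> other than \<open>j0\<close> one at a time,
  starting from the projective point with all coordinates equal, gives a chain attaining the bound
  of \<open>chain_length_less\<close>.\<close>

lemma proj_dim_toric_variety:
  "proj_dim (toric_variety A :: ('k::field_char_0^'n) set) = enat (card J - 1)"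
proof -
  let ?X = "toric_variety A :: ('k^'n) set"
  define L where "L = {enat k |k. \<exists>Z :: nat \<Rightarrow> ('k^'n) set.
     (\<forall>i\<le>k. irreducible_closed (Z i) \<and> Z i \<subseteq> ?X) \<and> (\<forall>i<k. Z i \<subset> Z (Suc i))}"
  have "l \<le> enat (card J - 1)" if l: "l \<in> L" for l
  proof -
    obtain k and Z :: "nat \<Rightarrow> ('k^'n) set" where Z: "l = enat k"
      "\<forall>i\<le>k. irreducible_closed (Z i) \<and> Z i \<subseteq> ?X" "\<forall>i<k. Z i \<subset> Z (Suc i)"
      using l unfolding L_def by blast
    then have "k < card J" by (intro chain_length_less[of k Z]) auto
    then show ?thesis using Z(1) by simp
  qed
  moreover have "enat (card J - 1) \<in> L"
  proof -
    obtain j0 where j0: "j0 \<in> J" using J_nonempty by blast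
    obtain js where js: "set js = J - {j0}" "distinct js" using finite_distinct_list[of "J - {j0}"] by auto
    have len: "length js = card J - 1" using distinct_card[OF js(2)] js(1) j0 by simp
    define Z where "Z = (\<lambda>i. zariski_closed hull (subtorus (set (take i js)) :: ('k^'n) set))"
    have sub: "set (take i js) \<subseteq> J - {j0}" for i using set_take_subset[of i js] js(1) by blast
    have "irreducible_closed (Z i) \<and> Z i \<subseteq> ?X" for i
      unfolding Z_def using sub[of i]
      by (intro conjI irreducible_closed_subtorus hull_minimal subtorus_subset zariski_closed_toric_variety) auto
    moreover have "Z i \<subset> Z (Suc i)" if i: "i < card J - 1" for i
    proof -
      have i': "i < length js" using i len by simp
      have step: "set (take (Suc i) js) = insert (js ! i) (set (take i js))"
        using i' by (simp add: take_Suc_conv_app_nth)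
      have "distinct (take (Suc i) js)" using js(2) by simp
      then have new: "js ! i \<notin> set (take i js)" using i' by (simp add: take_Suc_conv_app_nth)
      show ?thesis unfolding Z_def step
        by (rule subtorus_hull_psubset[OF _ new j0]) (use sub[of "Suc i"] step in auto)
    qed
    ultimately show ?thesis unfolding L_def by blast
  qed
  ultimately have "Sup L = enat (card J - 1)" by (intro antisym Sup_least Sup_upper)
  then show ?thesis unfolding proj_dim_def L_def .
qed

end


section \<open>Self-duality\<close>

lemma order_prod_power:
  fixes g :: "'i \<Rightarrow> 'a::idom poly"
  assumes "finite S" "\<And>j. j \<in> S \<Longrightarrow> g j \<noteq> 0"
  shows "order a (\<Prod>j\<in>S. g j ^ k j) = (\<Sum>j\<in>S. k j * order a (g j))"
proof -
  have pow: "order a (p ^ n) = n * order a p" if "p \<noteq> 0" for p :: "'a poly" and n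
    by (induction n) (simp_all add: order_mult that)
  from assms show ?thesis
    by (induction S) (simp_all add: order_mult pow)
qed

lemma zariski_closed_dual: "zariski_closed (dual_variety X)"
  unfolding dual_variety_def by (rule zariski_closed_hull) simp

lemma form_diagonal: "form 1 (\<lambda>x. (\<chi> k. p $ k * x $ k) $ i)"
  using form_scale[OF form_coord[of i], of "p $ i"] by simp

lemma monom_val_divide:
  "monom_val e (\<chi> k. p $ k / q $ k) = (monom_val e p / monom_val e q :: 'k::field)"
  by (simp add: monom_val_def power_divide prod_dividef)

section \<open>Conormal vectors and translates inside the dual variety\<close>

context column_basis
begin

lemma toric_variety_one: "(\<chi> i. 1) \<in> (toric_variety A :: ('k::field^'n) set)"
  by (simp add: toric_variety_iff monom_val_def vec_eq_iff)

lemma toric_variety_inverse: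
  fixes x :: "'k::field^'n"
  assumes "x \<in> toric_variety A" "\<And>i. x $ i \<noteq> 0"
  shows "(\<chi> i. 1 / x $ i) \<in> toric_variety A"
  using assms monom_val_divide[of _ "\<chi> i. 1" x]
  by (auto simp: toric_variety_iff monom_val_def vec_eq_iff)

lemma regular_torus_point:
  fixes x :: "'k::field_char_0^'n"
  assumes "x \<in> toric_variety A" "\<And>i. x $ i \<noteq> 0"
  shows "x \<in> regular_points (toric_variety A)"
proof -
  have "card J > 0" using J_nonempty by (simp add: card_gt_0_iff)
  then show ?thesis
    using assms(1) dim_tangent_space[OF assms] unfolding regular_points_def proj_dim_toric_variety
    by (simp add: one_enat_def)
qed

text \<open>The kernel of \<open>A\<close> over the field, given by the equations of
  \<open>kernel_iff\<close>.\<close>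

definition field_kernel :: "('k::field_char_0^'n) set" where
  "field_kernel = {p. (\<forall>j\<in>J. (\<Sum>i\<in>UNIV. of_int (w j i) * p $ i) = 0)}"

text \<open>The conormal vectors at a torus point \<open>x\<close> are the vectors \<open>p / x\<close> with \<open>p\<close> in the kernel.\<close>

lemma conormal_in_dual:
  fixes x p :: "'k::field_char_0^'n"
  assumes x: "x \<in> toric_variety A" "\<And>i. x $ i \<noteq> 0" and p: "p \<in> field_kernel" "\<And>i. p $ i \<noteq> 0"
  shows "(\<chi> i. p $ i / x $ i) \<in> dual_variety (toric_variety A)"
proof -
  define y where "y = (\<chi> i. p $ i / x $ i)"
  have y: "y $ i \<noteq> 0" for i using x p by (simp add: y_def)
  have ortho: "(\<Sum>i\<in>UNIV. p $ i * r i) = 0"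
    if r: "\<And>i. of_int N * r i = (\<Sum>j\<in>J. of_int (w j i) * s j)" for r s
  proof -
    have "of_int N * (\<Sum>i\<in>UNIV. p $ i * r i) = (\<Sum>i\<in>UNIV. p $ i * (of_int N * r i))"
      by (simp add: sum_distrib_left mult.left_commute)
    also have "\<dots> = (\<Sum>j\<in>J. s j * (\<Sum>i\<in>UNIV. of_int (w j i) * p $ i))"
      unfolding r sum_distrib_left by (subst sum.swap) (simp add: algebra_simps)
    also have "\<dots> = 0" using p(1) by (simp add: field_kernel_def)
    finally show ?thesis using N_pos by simp
  qed
  \<comment> \<open>The all-ones vector lies in the row space by \<open>w_sum\<close>, so
    \<open>x\<close> itself lies on the hyperplane.\<close>
  have "(\<Sum>i\<in>UNIV. p $ i * 1) = 0"
    by (rule ortho[of _ "\<lambda>_. 1"]) (simp flip: of_int_sum add: w_sum)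
  then have "x \<in> hyperplane y" using x(2) by (simp add: hyperplane_def y_def)
  moreover have "tangent_space (toric_variety A) x \<subseteq> hyperplane y"
  proof
    fix v assume "v \<in> tangent_space (toric_variety A) x"
    then have "(\<Sum>i\<in>UNIV. p $ i * (v $ i / x $ i)) = 0"
      unfolding tangent_space_eq[OF x] by (intro ortho[of _ "\<lambda>j. v $ j / x $ j"]) blast
    then show "v \<in> hyperplane y" by (simp add: hyperplane_def y_def)
  qed
  then have "{v + w |v w. v \<in> tangent_space (toric_variety A) x \<and> w \<in> hyperplane y} \<subseteq> hyperplane y"
    by (auto simp: hyperplane_def algebra_simps sum.distrib)
  moreover have "axis undefined 1 \<notin> hyperplane y"
    using y[of undefined] by (simp add: hyperplane_def axis_def if_distrib[of "\<lambda>c. _ * c"] cong: if_cong)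
  ultimately have "nontransversal_at (toric_variety A) y x" unfolding nontransversal_at_def by blast
  moreover have "y \<noteq> 0" using y by (metis zero_index)
  ultimately have "y \<in> {y. y \<noteq> 0 \<and> (\<exists>x\<in>regular_points (toric_variety A). nontransversal_at (toric_variety A) y x)}"
    using regular_torus_point[OF x] by blast
  then show ?thesis unfolding dual_variety_def y_def by (rule hull_inc)
qed

text \<open>For a torus point \<open>z\<close>, the product of \<open>p\<close> and \<open>z\<close>
  is conormal at the inverse of \<open>z\<close>. A form vanishing on the dual, pulled back along
  scaling by \<open>p\<close>, thus vanishes on the torus and by density on the whole
  variety.\<close>

lemma translate_in_dual:
  fixes x p :: "'k::field_char_0^'n"
  assumes p: "p \<in> field_kernel" "\<And>i. p $ i \<noteq> 0" and x: "x \<in> toric_variety A"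
  shows "(\<chi> i. p $ i * x $ i) \<in> dual_variety (toric_variety A)"
proof (rule ccontr)
  assume notin: "(\<chi> i. p $ i * x $ i) \<notin> dual_variety (toric_variety A)"
  have "x \<noteq> 0" using x by (simp add: toric_variety_iff)
  then have "(\<chi> i. p $ i * x $ i) \<noteq> 0" using p(2) by (simp add: vec_eq_iff)
  then obtain D f where f: "form D f" "\<And>z. z \<in> dual_variety (toric_variety A) \<Longrightarrow> f z = 0" "f (\<chi> i. p $ i * x $ i) \<noteq> 0"
    using zariski_closed_obtain_form[OF zariski_closed_dual _ notin] by blast
  have "f (\<chi> i. p $ i * x $ i) = 0"
  proof (rule form_vanishes_toric_variety[OF form_subst[OF f(1) form_diagonal] _ x])
    fix z :: "'k^'n" assume z: "z \<in> toric_variety A" "\<And>i. z $ i \<noteq> 0"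
    have "(\<chi> i. p $ i / (\<chi> i. 1 / z $ i) $ i) \<in> dual_variety (toric_variety A)"
      by (rule conormal_in_dual[OF toric_variety_inverse[OF z] _ p]) (use z in simp)
    then show "f (\<chi> i. p $ i * z $ i) = 0" using f(2) by simp
  qed
  with f(3) show False by simp
qed

text \<open>Scaling by \<open>p\<close> followed by the inverse of \<open>P\<close> maps the variety
  into itself, so its inverse \<open>R\<close> does too by
  \<open>zariski_closed_inverse_invariant\<close>. As \<open>p'\<close> lies in the dual, it is
  \<open>P *v z\<close> for a point \<open>z\<close>, and \<open>R z\<close> is the ratio.\<close>

lemma self_dual_kernel_ratio:
  fixes p p' :: "'k::field_char_0^'n"
  assumes dual: "self_dual (toric_variety A :: ('k^'n) set)"
    and p: "p \<in> field_kernel" "\<And>i. p $ i \<noteq> 0" and p': "p' \<in> field_kernel" "\<And>i. p' $ i \<noteq> 0"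
  shows "(\<chi> i. p' $ i / p $ i) \<in> toric_variety A"
proof -
  obtain P :: "'k^'n^'n" where P: "invertible P" "(*v) P ` toric_variety A = dual_variety (toric_variety A)"
    using dual unfolding self_dual_def by blast
  then obtain P' where P': "P ** P' = mat 1" "P' ** P = mat 1" unfolding invertible_def by blast
  define L where "L = (\<lambda>x. P' *v (\<chi> i. p $ i * x $ i))"
  define R where "R = (\<lambda>x. \<chi> i. (P *v x) $ i / p $ i)"
  have R: "R x \<in> toric_variety A" if x: "x \<in> toric_variety A" "R x \<noteq> 0" for x
  proof (rule zariski_closed_inverse_invariant[where L = L and R = R, OF zariski_closed_toric_variety _ _ _ x])
    show "form 1 (\<lambda>x. L x $ i)" for i
      unfolding L_def by (intro form_subst[OF form_matrix form_diagonal])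
    show "L (R x) = x" for x
      using p(2) by (simp add: L_def R_def matrix_vector_mul_assoc P')
    show "L x \<in> toric_variety A" if x: "x \<in> toric_variety A" for x
    proof -
      obtain z where "z \<in> toric_variety A" "(\<chi> i. p $ i * x $ i) = P *v z"
        using translate_in_dual[OF p x] P(2) by blast
      then show ?thesis by (simp add: L_def matrix_vector_mul_assoc P')
    qed
  qed
  have "p' \<in> dual_variety (toric_variety A)"
    using translate_in_dual[OF p' toric_variety_one] by simp
  then obtain z where z: "z \<in> toric_variety A" "p' = P *v z" using P(2) by blast
  have "R z = (\<chi> i. p' $ i / p $ i)" by (simp add: R_def z(2))
  moreover have "(\<chi> i. p' $ i / p $ i) \<noteq> 0" using p(2) p'(2) by (simp add: vec_eq_iff)
  ultimately show ?thesis using R[OF z(1)] by simp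
qed

text \<open>
  Along the line \<open>q + z v\<close> the monomials \<open>pos_part v\<close> and \<open>neg_part v\<close> are proportional,
  so they vanish to the same order at \<open>z = 0\<close>.
\<close>

lemma self_dual_class_sum:
  fixes q v :: "int^'n"
  assumes dual: "self_dual (toric_variety A :: ('k::field_char_0^'n) set)"
    and q: "q \<in> int_kernel A" and v: "v \<in> int_kernel A" "\<And>i. v $ i \<noteq> 0"
  shows "(\<Sum>j | q $ j = 0. v $ j) = 0"
proof -
  define l :: "'n \<Rightarrow> 'k poly" where "l = (\<lambda>j. [:of_int (q $ j), of_int (v $ j):])"
  define p where "p = (\<lambda>z. \<chi> j. poly (l j) z)"
  have ker: "p z \<in> field_kernel" for z
  proof -
    have "(\<Sum>i\<in>UNIV. of_int (w j i) * p z $ i) =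
        of_int (\<Sum>i\<in>UNIV. w j i * q $ i) + z * of_int (\<Sum>i\<in>UNIV. w j i * v $ i)" for j
      by (simp add: p_def l_def algebra_simps sum.distrib sum_distrib_left)
    then show ?thesis using q v(1) unfolding kernel_iff field_kernel_def by (simp del: of_int_sum of_int_mult)
  qed
  have l0: "l j \<noteq> 0" for j using v(2) by (simp add: l_def)
  \<comment> \<open>Exactly the coordinates with \<open>q $ j = 0\<close> vanish at parameter 0, and
    to first order because \<open>v $ j\<close> is nonzero.\<close>
  have ord: "order 0 (l j) = (if q $ j = 0 then 1 else 0)" for j
  proof (cases "q $ j = 0")
    case True
    then have "l j = monom (of_int (v $ j)) 1" by (simp add: l_def monom_Suc monom_0)
    then show ?thesis using True v(2) by (simp add: order_0_monom del: monom_eq_1_iff)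
  next
    case False
    then show ?thesis by (simp add: l_def order_0I)
  qed
  define bad where "bad = {z. poly (\<Prod>j\<in>UNIV. l j) z = 0}"
  have bad: "finite bad" unfolding bad_def by (rule poly_roots_finite) (simp add: l0)
  have good: "p z $ i \<noteq> 0" if "z \<notin> bad" for z i using that by (simp add: bad_def p_def poly_prod)
  obtain z0 where z0: "z0 \<notin> bad"
    using ex_new_if_finite[OF infinite_UNIV_char_0[where 'a = 'k] bad] by blast
  define mon where "mon = (\<lambda>e :: nat^'n. \<Prod>j\<in>UNIV. l j ^ e $ j)"
  have mon: "poly (mon e) z = monom_val e (p z)" for e z
    by (simp add: mon_def monom_val_def p_def poly_prod)
  \<comment> \<open>The proportionality of the two monomials, normalised at \<open>z0\<close>, as a
    polynomial in \<open>z\<close>; \<open>self_dual_kernel_ratio\<close> gives it infinitely many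
    roots.\<close>
  define F where "F = smult (monom_val (neg_part v) (p z0)) (mon (pos_part v)) -
      smult (monom_val (pos_part v) (p z0)) (mon (neg_part v))"
  have "poly F z = 0" if z: "z \<notin> bad" for z
  proof -
    have "(\<chi> i. p z $ i / p z0 $ i) \<in> toric_variety A"
      by (rule self_dual_kernel_ratio[OF dual ker good[OF z0] ker good[OF z]])
    then have "monom_val (pos_part v) (p z) / monom_val (pos_part v) (p z0) =
        monom_val (neg_part v) (p z) / monom_val (neg_part v) (p z0)"
      using v(1) unfolding toric_variety_iff monom_val_divide by blast
    then show ?thesis
      using monom_val_nonzero[OF good[OF z0]] by (simp add: F_def mon field_simps)
  qed
  then have "UNIV - bad \<subseteq> {z. poly F z = 0}" by auto
  moreover have "infinite (UNIV - bad)" using bad infinite_UNIV_char_0 by simp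
  ultimately have "F = 0" using poly_roots_finite finite_subset by blast
  then have "order 0 (smult (monom_val (neg_part v) (p z0)) (mon (pos_part v))) =
      order 0 (smult (monom_val (pos_part v) (p z0)) (mon (neg_part v)))" by (simp add: F_def)
  then have "order 0 (mon (pos_part v)) = order 0 (mon (neg_part v))"
    using monom_val_nonzero[OF good[OF z0]] by (simp add: order_smult)
  moreover have "order 0 (mon e) = (\<Sum>j | q $ j = 0. e $ j)" for e
  proof -
    have "order 0 (mon e) = (\<Sum>j\<in>UNIV. if q $ j = 0 then e $ j else 0)"
      unfolding mon_def by (subst order_prod_power) (auto simp: l0 ord intro!: sum.cong)
    then show ?thesis by (simp add: sum.If_cases)
  qed
  ultimately have "(\<Sum>j | q $ j = 0. int (pos_part v $ j)) = (\<Sum>j | q $ j = 0. int (neg_part v $ j))"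
    by (simp flip: of_nat_sum)
  then have "(\<Sum>j | q $ j = 0. int (pos_part v $ j) - int (neg_part v $ j)) = 0"
    by (simp only: sum_subtractf)
  then show ?thesis by (simp only: pos_neg_parts)
qed

end

section \<open>Proportional coordinates of opposite sign\<close>

lemma int_kernel_avoid_zeros:
  assumes V: "\<And>u v c. u \<in> V \<Longrightarrow> v \<in> V \<Longrightarrow> c *s u + v \<in> V" "0 \<in> V"
    and I: "\<And>i. i \<in> I \<Longrightarrow> \<exists>v\<in>V. v $ i \<noteq> (0 :: int)"
  shows "\<exists>v\<in>V. \<forall>i\<in>I. v $ i \<noteq> 0"
proof -
  have "\<exists>f\<in>vec_nth ` V. \<forall>i\<in>I. f i \<noteq> 0"
  proof (rule avoid_zeros)
    show "(\<lambda>_. 0) \<in> vec_nth ` V" using V(2) by (intro image_eqI[of _ _ 0]) auto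
    fix f g c assume "f \<in> vec_nth ` V" "g \<in> vec_nth ` V"
    then obtain u v where "u \<in> V" "v \<in> V" "f = vec_nth u" "g = vec_nth v" by blast
    then show "(\<lambda>i. c * f i + g i) \<in> vec_nth ` V"
      using V(1)[of u v c] by (intro image_eqI[of _ _ "c *s u + v"]) auto
  qed (use I in auto)
  then show ?thesis by blast
qed

lemma self_dual_imp_mixed:
  fixes A :: "int^'n^'m"
  assumes ones: "ones_in_row_span A" and pyr: "non_pyramidal A"
    and dual: "self_dual (toric_variety A :: ('k::field_char_0^'n) set)"
  shows "\<exists>j a b. a > 0 \<and> b > 0 \<and> (\<forall>u\<in>int_kernel A. a * u $ j = - b * u $ i)"
proof -
  obtain J N w where "column_basis A J N w" using column_basis_exists[OF ones] by blast
  then interpret column_basis A J N w .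
  have "\<exists>v\<in>int_kernel A. \<forall>i\<in>UNIV. v $ i \<noteq> 0"
    by (rule int_kernel_avoid_zeros)
      (use pyr in \<open>auto simp: non_pyramidal_def free_vector_def intro: int_kernel_add int_kernel_scale\<close>)
  then obtain v where v: "v \<in> int_kernel A" "\<And>i. v $ i \<noteq> 0" by blast
  \<comment> \<open>These turn out to be the coordinates proportional to the \<open>i\<close>-th one
    on the kernel; a generic \<open>q\<close> with \<open>q $ i = 0\<close> vanishes exactly
    there.\<close>
  define L where "L = {j. \<forall>u\<in>int_kernel A. u $ i = 0 \<longrightarrow> u $ j = 0}"
  have "\<exists>q\<in>{u \<in> int_kernel A. u $ i = 0}. \<forall>j\<in>- L. q $ j \<noteq> 0"
    by (rule int_kernel_avoid_zeros) (auto simp: L_def intro: int_kernel_add int_kernel_scale)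
  then obtain q where q: "q \<in> int_kernel A" "q $ i = 0" "\<And>j. j \<notin> L \<Longrightarrow> q $ j \<noteq> 0" by blast
  have "{j. q $ j = 0} = L" using q by (auto simp: L_def)
  with self_dual_class_sum[OF dual q(1) v] have sum: "(\<Sum>j\<in>L. v $ j) = 0" by simp
  \<comment> \<open>The entries of \<open>v\<close> over \<open>L\<close> sum to zero while
    \<open>v $ i\<close> is nonzero, so one of them has the opposite sign.\<close>
  have "\<exists>j\<in>L. v $ i * v $ j < 0"
  proof (rule ccontr)
    assume "\<not> ?thesis"
    then have "\<forall>j\<in>L. v $ i * v $ j \<ge> 0" by auto
    moreover have "i \<in> L" by (simp add: L_def)
    moreover have "v $ i * v $ i > 0" using v(2)[of i] by (auto simp: zero_less_mult_iff)
    ultimately have "(\<Sum>j\<in>L. v $ i * v $ j) > 0" by (intro sum_pos2[of L i]) auto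
    with sum show False by (simp flip: sum_distrib_left)
  qed
  then obtain j where j: "j \<in> L" "v $ i * v $ j < 0" by blast
  \<comment> \<open>The kernel vector \<open>v $ i *s u - u $ i *s v\<close> vanishes at
    \<open>i\<close> by construction, hence at \<open>j\<close>.\<close>
  have ratio: "v $ i * u $ j = v $ j * u $ i" if "u \<in> int_kernel A" for u
  proof -
    have "v $ i *s u - u $ i *s v \<in> int_kernel A" using that v(1) by (intro int_kernel_diff int_kernel_scale)
    moreover have "(v $ i *s u - u $ i *s v) $ i = 0" by (simp add: mult.commute)
    ultimately have "(v $ i *s u - u $ i *s v) $ j = 0" using j(1) unfolding L_def by blast
    then show ?thesis by (simp add: algebra_simps)
  qed
  from j(2) consider "v $ i > 0" "v $ j < 0" | "v $ i < 0" "v $ j > 0" by (auto simp: mult_less_0_iff)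
  then show ?thesis
  proof cases
    case 1
    with ratio show ?thesis by (intro exI[of _ j] exI[of _ "v $ i"] exI[of _ "- v $ j"]) auto
  next
    case 2
    with ratio show ?thesis by (intro exI[of _ j] exI[of _ "- v $ i"] exI[of _ "v $ j"]) auto
  qed
qed

theorem theorem4p2:
  fixes A :: "int^'n^'m"
  assumes "ones_in_row_span A"
    and "non_pyramidal A"
    and "self_dual (toric_variety A :: ('k::{alg_closed_field, field_char_0}^'n) set)"
  shows "strongly_robust TYPE('k) A"
  using strongly_robust_if_mixed[OF self_dual_imp_mixed[OF assms]] .

end
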